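(* Let $m,n\ge 1$, let $\|\cdot\|$ be a differentiable, strictly convex, non-Euclidean norm on $\mathbb{R}^2$, and let $\mathcal{G}(\mathcal{B})$ be an $m\times n$ braced grid (of squares) bar-joint framework in $\mathbb{R}^2$ (of any inclination) with braces set $\mathcal{B}\subseteq \mathcal{B}_{\rm max}$. Then the following are equivalent. (i) $\mathcal{G}(\mathcal{B})$ is infinitesimally rigid in $(\mathbb{R}^2,\|\cdot\|)$. (ii) $\mathcal{G}(\mathcal{B}_{\rm max})$ is infinitesimally rigid in $(\mathbb{R}^2,\|\cdot\|)$, and the bicoloured braces graph of $\mathcal{G}(\mathcal{B})$ is a spanning subgraph of $K^2_{m,n}$ with an independent cycle in each path-connected component.
   Context: Norms. A norm on $\mathbb{R}^2$ is differentiable if it is differentiable away from $0$ (its unit sphere has a well-defined tangent at every point). It is non-Euclidean if it is not induced by an inner product. Frameworks. A bar-joint framework $(G,p)$ in $\mathbb{R}^2$ is a simple graph $G=(V,E)$ with a placement $p:V\to\mathbb{R}^2$, $v_i\mapsto p_i$. An infinitesimal flex with respect to $\|\cdot\|$ is an assignment of vectors $u_i\in\mathbb{R}^2$ to the vertices with $\|(p_i+tu_i)-(p_j+tu_j)\|-\|p_i-p_j\|=o(t)$ as $t\to 0+$ for each edge $v_iv_j$. A rigid motion flex of a framework is an infinitesimal flex which extends to an infinitesimal flex of every framework containing it (for a non-Euclidean norm these are exactly the translation flexes: all $u_i$ equal). A framework is infinitesimally rigid in $(\mathbb{R}^2,\|\cdot\|)$ if all its infinitesimal flexes with respect to $\|\cdot\|$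 are rigid motion flexes. Grids. The unbraced $m\times n$ grid framework of inclination $\alpha\in[0,\pi/2)$ has as joints the image, under rotation by $\alpha$ followed by a translation, of the points $(j,k)$, $0\le j\le m$, $0\le k\le n$ (integers), with bars joining the images of points at distance 1. Each of its $mn$ unit squares has two possible diagonal braces, and $\mathcal{B}_{\rm max}$ is the set of all $2mn$ possible diagonal braces. For $\mathcal{B}\subseteq\mathcal{B}_{\rm max}$, $\mathcal{G}(\mathcal{B})$ is the framework obtained by adding the braces in $\mathcal{B}$ as bars (so each square has 0, 1 or 2 braces; crossing braces are not joined where they cross). Braces graph. $K^2_{m,n}$ is the multigraph obtained from the complete bipartite graph $K_{m,n}$ by doubling each edge, one copy coloured blue and the other red. The vertices of $K_{m,n}$ correspond to the $m$ columns and the $n$ rows of squares of the grid, so each edge of $K_{m,n}$ corresponds to a square. All diagonals in one of the two translation classes are called blue, those in the other class red, and a brace corresponds to the edge of $K^2_{m,n}$ for its square with its colour. The bicoloured braces graph of $\mathcal{G}(\mathcal{B})$ is the subgraph of $K^2_{m,n}$ consisting of the edges corresponding to the braces in $\mathcal{B}$ and their end vertices. It is spanning if every vertex of $K^2_{m,n}$ belongs to it. Independent cycles. A cycle with consecutive edges $e_1,\dots,e_{2k}$ in $K^2_{m,n}$ (with $k=1$ allowed, the cycle then consisting of the blue and the red edge between two vertices) is dependent if the number of blue edges in $\{e_1,e_3,\dots,e_{2k-1}\}$ equals the number of blue edges in $\{e_2,e_4,\dots,e_{2k}\}$, and is independent otherwise. *)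

theory Defs
  imports "HOL-Analysis.Analysis" "HOL-Library.Landau_Symbols"
begin

section \<open>Norms on the plane\<close>

definition is_norm :: "(real^2 \<Rightarrow> real) \<Rightarrow> bool" where
  "is_norm N \<longleftrightarrow>
     (\<forall>x. N x \<ge> 0) \<and> (\<forall>x. N x = 0 \<longleftrightarrow> x = 0) \<and>
     (\<forall>c x. N (c *\<^sub>R x) = \<bar>c\<bar> * N x) \<and> (\<forall>x y. N (x + y) \<le> N x + N y)"

definition differentiable_norm :: "(real^2 \<Rightarrow> real) \<Rightarrow> bool" where
  "differentiable_norm N \<longleftrightarrow> (\<forall>x. x \<noteq> 0 \<longrightarrow> N differentiable (at x))"

definition strictly_convex_norm :: "(real^2 \<Rightarrow> real) \<Rightarrow> bool" where
  "strictly_convex_norm N \<longleftrightarrow>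
     (\<forall>x y t. N x = 1 \<longrightarrow> N y = 1 \<longrightarrow> x \<noteq> y \<longrightarrow> 0 < t \<longrightarrow> t < 1 \<longrightarrow>
        N ((1 - t) *\<^sub>R x + t *\<^sub>R y) < 1)"

definition inner_product :: "(real^2 \<Rightarrow> real^2 \<Rightarrow> real) \<Rightarrow> bool" where
  "inner_product b \<longleftrightarrow>
     bilinear b \<and> (\<forall>x y. b x y = b y x) \<and> (\<forall>x. x \<noteq> 0 \<longrightarrow> b x x > 0)"

definition euclidean_norm :: "(real^2 \<Rightarrow> real) \<Rightarrow> bool" where
  "euclidean_norm N \<longleftrightarrow> (\<exists>b. inner_product b \<and> (\<forall>x. N x = sqrt (b x x)))"


section \<open>Bar-joint frameworks\<close>

text \<open>Placements and flexes are total functions on the vertex type; only their values on the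
  joints matter.\<close>

record 'v framework =
  joints :: "'v set"
  bars :: "'v set set"
  place :: "'v \<Rightarrow> real^2"

definition bar_joint_framework :: "'v framework \<Rightarrow> bool" where
  "bar_joint_framework F \<longleftrightarrow>
     bars F \<subseteq> {{i, j} | i j. i \<in> joints F \<and> j \<in> joints F \<and> i \<noteq> j}"

definition subframework :: "'v framework \<Rightarrow> 'v framework \<Rightarrow> bool" where
  "subframework F F' \<longleftrightarrow>
     joints F \<subseteq> joints F' \<and> bars F \<subseteq> bars F' \<and> (\<forall>v\<in>joints F. place F' v = place F v)"

definition infinitesimal_flex ::
    "(real^2 \<Rightarrow> real) \<Rightarrow> 'v framework \<Rightarrow> ('v \<Rightarrow> real^2) \<Rightarrow> bool" where
  "infinitesimal_flex N F u \<longleftrightarrow>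
     (\<forall>i j. {i, j} \<in> bars F \<longrightarrow>
        (\<lambda>t. N ((place F i + t *\<^sub>R u i) - (place F j + t *\<^sub>R u j)) - N (place F i - place F j))
          \<in> o[at_right 0](\<lambda>t. t))"

text \<open>The containing frameworks range over the vertex type of the given framework. If that type
  is infinite, as for the grids below, then up to renaming of the new joints every countable
  framework containing a given finite one occurs.\<close>

definition rigid_motion_flex ::
    "(real^2 \<Rightarrow> real) \<Rightarrow> 'v framework \<Rightarrow> ('v \<Rightarrow> real^2) \<Rightarrow> bool" where
  "rigid_motion_flex N F u \<longleftrightarrow>
     infinitesimal_flex N F u \<and>
     (\<forall>F'. bar_joint_framework F' \<longrightarrow> subframework F F' \<longrightarrow>
        (\<exists>u'. infinitesimal_flex N F' u' \<and> (\<forall>v\<in>joints F. u' v = u v)))"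

definition infinitesimally_rigid :: "(real^2 \<Rightarrow> real) \<Rightarrow> 'v framework \<Rightarrow> bool" where
  "infinitesimally_rigid N F \<longleftrightarrow> (\<forall>u. infinitesimal_flex N F u \<longrightarrow> rigid_motion_flex N F u)"


section \<open>Braced grids\<close>

definition rotate_by :: "real \<Rightarrow> real^2 \<Rightarrow> real^2" where
  "rotate_by \<alpha> x = vector [cos \<alpha> * x$1 - sin \<alpha> * x$2, sin \<alpha> * x$1 + cos \<alpha> * x$2]"

definition lattice_point :: "nat \<times> nat \<Rightarrow> real^2" where
  "lattice_point v = vector [real (fst v), real (snd v)]"

definition grid_joints :: "nat \<Rightarrow> nat \<Rightarrow> (nat \<times> nat) set" where
  "grid_joints m n = {0..m} \<times> {0..n}"

definition grid_bars :: "nat \<Rightarrow> nat \<Rightarrow> (nat \<times> nat) set set" where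
  "grid_bars m n =
     {{v, w} | v w. v \<in> grid_joints m n \<and> w \<in> grid_joints m n \<and>
        dist (lattice_point v) (lattice_point w) = 1}"

datatype colour = Blue | Red

text \<open>The square in column \<open>i\<close> and row \<open>k\<close> is the one whose lower left corner is \<open>(i, k)\<close>.\<close>

fun brace :: "nat \<times> nat \<times> colour \<Rightarrow> (nat \<times> nat) set" where
  "brace (i, k, Blue) = {(i, k), (i + 1, k + 1)}"
| "brace (i, k, Red) = {(i + 1, k), (i, k + 1)}"

definition all_braces :: "nat \<Rightarrow> nat \<Rightarrow> (nat \<times> nat) set set" where
  "all_braces m n = {brace (i, k, c) | i k c. i < m \<and> k < n}"

definition braced_grid ::
    "nat \<Rightarrow> nat \<Rightarrow> real \<Rightarrow> real^2 \<Rightarrow> (nat \<times> nat) set set \<Rightarrow> (nat \<times> nat) framework" where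
  "braced_grid m n \<alpha> a B =
     \<lparr>joints = grid_joints m n,
      bars = grid_bars m n \<union> B,
      place = (\<lambda>v. rotate_by \<alpha> (lattice_point v) + a)\<rparr>"

lemma bar_joint_framework_braced_grid:
  assumes "B \<subseteq> all_braces m n"
  shows "bar_joint_framework (braced_grid m n \<alpha> a B)"
proof -
  have "grid_bars m n \<subseteq> {{v, w} | v w. v \<in> grid_joints m n \<and> w \<in> grid_joints m n \<and> v \<noteq> w}"
    unfolding grid_bars_def by fastforce
  moreover have "brace (i, k, c) \<in> {{v, w} | v w. v \<in> grid_joints m n \<and> w \<in> grid_joints m n \<and> v \<noteq> w}"
    if "i < m" "k < n" for i k c
  proof (cases c)
    case Blue
    then show ?thesis using that unfolding grid_joints_def
      by (intro CollectI exI[of _ "(i, k)"] exI[of _ "(i + 1, k + 1)"]) auto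
  next
    case Red
    then show ?thesis using that unfolding grid_joints_def
      by (intro CollectI exI[of _ "(i + 1, k)"] exI[of _ "(i, k + 1)"]) auto
  qed
  ultimately show ?thesis
    using assms unfolding bar_joint_framework_def braced_grid_def all_braces_def by auto
qed


section \<open>Bicoloured braces graphs\<close>

text \<open>An edge of the doubled complete bipartite graph is a triple of a column, a row and a colour;
  as vertices, column \<open>i\<close> is \<open>Inl i\<close> and row \<open>k\<close> is \<open>Inr k\<close>. A subgraph consisting of edges
  and their end vertices is represented by its set of edges.\<close>

type_synonym bedge = "nat \<times> nat \<times> colour"

definition K2_vertices :: "nat \<Rightarrow> nat \<Rightarrow> (nat + nat) set" where
  "K2_vertices m n = Inl ` {..<m} \<union> Inr ` {..<n}"

definition K2_edges :: "nat \<Rightarrow> nat \<Rightarrow> bedge set" where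
  "K2_edges m n = {..<m} \<times> {..<n} \<times> UNIV"

fun ends :: "bedge \<Rightarrow> (nat + nat) set" where
  "ends (i, k, c) = {Inl i, Inr k}"

definition colour_of :: "bedge \<Rightarrow> colour" where
  "colour_of e = snd (snd e)"

definition braces_graph :: "nat \<Rightarrow> nat \<Rightarrow> (nat \<times> nat) set set \<Rightarrow> bedge set" where
  "braces_graph m n B = {e \<in> K2_edges m n. brace e \<in> B}"

definition graph_vertices :: "bedge set \<Rightarrow> (nat + nat) set" where
  "graph_vertices E = (\<Union>e\<in>E. ends e)"

definition spanning :: "nat \<Rightarrow> nat \<Rightarrow> bedge set \<Rightarrow> bool" where
  "spanning m n E \<longleftrightarrow> K2_vertices m n \<subseteq> graph_vertices E"

definition adjacency :: "bedge set \<Rightarrow> ((nat + nat) \<times> (nat + nat)) set" where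
  "adjacency E = {(x, y). \<exists>e\<in>E. ends e = {x, y}}"

definition components :: "bedge set \<Rightarrow> (nat + nat) set set" where
  "components E = (\<lambda>v. (adjacency E)\<^sup>* `` {v}) ` graph_vertices E"

text \<open>\<open>es\<close> lists the consecutive edges of a cycle and \<open>vs\<close> the vertices it passes, edge
  \<open>es ! i\<close> joining \<open>vs ! i\<close> to its cyclic successor. Length 2 is allowed: the edges are then the
  blue and the red edge between two vertices.\<close>

definition is_cycle :: "bedge set \<Rightarrow> bedge list \<Rightarrow> bool" where
  "is_cycle E es \<longleftrightarrow>
     es \<noteq> [] \<and> even (length es) \<and> distinct es \<and> set es \<subseteq> E \<and>
     (\<exists>vs. length vs = length es \<and> distinct vs \<and>
        (\<forall>i<length es. ends (es ! i) = {vs ! i, vs ! (Suc i mod length es)}))"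

definition independent_cycle :: "bedge list \<Rightarrow> bool" where
  "independent_cycle es \<longleftrightarrow>
     card {i. i < length es \<and> even i \<and> colour_of (es ! i) = Blue} \<noteq>
     card {i. i < length es \<and> odd i \<and> colour_of (es ! i) = Blue}"

definition independent_cycle_in_each_component :: "bedge set \<Rightarrow> bool" where
  "independent_cycle_in_each_component E \<longleftrightarrow>
     (\<forall>C\<in>components E. \<exists>es. is_cycle E es \<and> independent_cycle es \<and> (\<forall>e\<in>set es. ends e \<subseteq> C))"

end

theory Submission
  imports Defs
begin

text \<open>The flexes of the unbraced grid are, up to translation, the shears: column \<open>i\<close> of squares moves
  by a multiple \<open>x\<^sub>i\<close> of a fixed vector tangent to the unit sphere, row \<open>k\<close> by a multiple \<open>y\<^sub>k\<close> of
  another one. A brace of colour \<open>c\<close> in the square \<open>(i, k)\<close> imposes \<open>y\<^sub>k = w\<^sub>c x\<^sub>i\<close>, and strict convexity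
  gives \<open>w\<^sub>c > 0\<close>. Going once around a cycle of the braces graph multiplies the unknowns by a power of
  \<open>w\<^sub>B / w\<^sub>R\<close> whose exponent is nonzero iff the cycle is independent. With all braces present, only
  the trivial shear remains iff \<open>w\<^sub>B \<noteq> w\<^sub>R\<close>.

  That a rigid motion flex is a translation is seen by extending it to the complete framework on the
  lattice points of a quadrant: the extension is affine, and unless its linear part vanishes, this
  part is a linear vector field tangent to all spheres of the norm, which makes the norm Euclidean.\<close>

section \<open>Differentiable norms on the plane\<close>

locale plane_norm =
  fixes N :: "real^2 \<Rightarrow> real"
  assumes norm: "is_norm N" and diff: "differentiable_norm N"
begin

definition dN :: "real^2 \<Rightarrow> real^2 \<Rightarrow> real" where
  "dN x = frechet_derivative N (at x)"

lemma N_nonneg: "0 \<le> N x"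
  and N_eq_0: "N x = 0 \<longleftrightarrow> x = 0"
  and N_scale: "N (c *\<^sub>R x) = \<bar>c\<bar> * N x"
  and N_triangle: "N (x + y) \<le> N x + N y"
  using norm unfolding is_norm_def by auto

lemma N_pos: "x \<noteq> 0 \<Longrightarrow> 0 < N x"
  using N_nonneg[of x] N_eq_0[of x] by linarith

lemma N_minus: "N (- x) = N x"
  using N_scale[of "- 1" x] by simp

lemma N_continuous: "continuous_on UNIV N"
proof (rule convex_on_continuous)
  have "N (u *\<^sub>R x + v *\<^sub>R y) \<le> u * N x + v * N y" if "0 \<le> u" "0 \<le> v" for u v x y
    using N_triangle[of "u *\<^sub>R x" "v *\<^sub>R y"] that by (simp add: N_scale)
  then show "convex_on UNIV N"
    by (intro convex_onI) auto
qed auto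

lemma has_derivative_N: "x \<noteq> 0 \<Longrightarrow> (N has_derivative dN x) (at x)"
  using diff unfolding differentiable_norm_def dN_def by (simp add: frechet_derivative_works)

lemma linear_dN: "x \<noteq> 0 \<Longrightarrow> linear (dN x)"
  using has_derivative_N has_derivative_linear by blast

lemmas dN_linear =
  linear_dN[THEN linear_add] linear_dN[THEN linear_diff] linear_dN[THEN linear_cmul] linear_dN[THEN linear_0]

lemma has_real_derivative_N_line:
  assumes "x \<noteq> 0"
  shows "((\<lambda>t. N (x + t *\<^sub>R v)) has_real_derivative dN x v) (at 0)"
proof -
  have "((\<lambda>t. N (x + t *\<^sub>R v)) has_derivative (\<lambda>t. dN x (t *\<^sub>R v))) (at 0)"
    by (rule has_derivative_compose[where g = N and f = "\<lambda>t. x + t *\<^sub>R v"])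
      (use has_derivative_N[OF assms] in \<open>auto intro!: derivative_eq_intros\<close>)
  then show ?thesis
    unfolding has_field_derivative_def using dN_linear(3)[OF assms]
    by (simp add: mult_commute_abs)
qed

lemma quotient_tendsto_dN:
  assumes "x \<noteq> 0"
  shows "((\<lambda>t. (N (x + t *\<^sub>R v) - N x) / t) \<longlongrightarrow> dN x v) (at_right 0)"
  using has_real_derivative_N_line[OF assms, of v] unfolding has_field_derivative_iff
  by (simp add: filterlim_at_split)

text \<open>The flex condition is one-sided, but by differentiability the one-sided quotient
  converges to \<open>dN x v\<close>. So the little-o condition is a linear equation in
  \<open>v\<close>.\<close>

lemma first_order_flex_iff:
  assumes "x \<noteq> 0"
  shows "(\<lambda>t. N (x + t *\<^sub>R v) - N x) \<in> o[at_right 0](\<lambda>t. t) \<longleftrightarrow> dN x v = 0"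
proof
  assume "(\<lambda>t. N (x + t *\<^sub>R v) - N x) \<in> o[at_right 0](\<lambda>t. t)"
  then have "((\<lambda>t. (N (x + t *\<^sub>R v) - N x) / t) \<longlongrightarrow> 0) (at_right 0)"
    by (rule smalloD_tendsto)
  then show "dN x v = 0"
    by (rule tendsto_unique[OF trivial_limit_at_right_real quotient_tendsto_dN[OF assms]])
next
  have nz: "\<forall>\<^sub>F t in at_right 0. t \<noteq> (0::real)"
    by (rule eventually_mono[OF eventually_at_right_less]) auto
  assume "dN x v = 0"
  then show "(\<lambda>t. N (x + t *\<^sub>R v) - N x) \<in> o[at_right 0](\<lambda>t. t)"
    using smalloI_tendsto[OF _ nz] quotient_tendsto_dN[OF assms, of v] by simp
qed

text \<open>Euler's relation for a function homogeneous of degree 1.\<close>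

lemma dN_self:
  assumes "x \<noteq> 0"
  shows "dN x x = N x"
proof -
  have "\<forall>\<^sub>F t in at_right 0. (N (x + t *\<^sub>R x) - N x) / t = N x"
  proof (rule eventually_mono[OF eventually_at_right_less])
    fix t :: real assume "0 < t"
    have "N (x + t *\<^sub>R x) = N ((1 + t) *\<^sub>R x)" by (simp add: algebra_simps)
    also have "\<dots> = (1 + t) * N x" using \<open>0 < t\<close> by (subst N_scale) auto
    finally show "(N (x + t *\<^sub>R x) - N x) / t = N x"
      using \<open>0 < t\<close> by (simp add: field_simps)
  qed
  then have "((\<lambda>t. (N (x + t *\<^sub>R x) - N x) / t) \<longlongrightarrow> N x) (at_right 0)"
    by (simp add: tendsto_eventually)
  then show ?thesis
    by (rule tendsto_unique[OF trivial_limit_at_right_real quotient_tendsto_dN[OF assms]])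
qed

text \<open>By convexity the difference quotient at \<open>t < 1\<close> is at most the one at 1;
  let \<open>t\<close> tend to 0.\<close>

lemma subgradient:
  assumes "x \<noteq> 0"
  shows "N x + dN x v \<le> N (x + v)"
proof -
  have "\<forall>\<^sub>F t in at_right 0. t < (1::real)"
    using eventually_at_right_real[of 0 1] by (auto elim: eventually_mono)
  then have "\<forall>\<^sub>F t in at_right 0. (N (x + t *\<^sub>R v) - N x) / t \<le> N (x + v) - N x"
    using eventually_at_right_less[of "0::real"]
  proof eventually_elim
    case (elim t)
    have "N (x + t *\<^sub>R v) = N ((1 - t) *\<^sub>R x + t *\<^sub>R (x + v))"
      by (simp add: algebra_simps)
    also have "\<dots> \<le> (1 - t) * N x + t * N (x + v)"
      using N_triangle[of "(1 - t) *\<^sub>R x" "t *\<^sub>R (x + v)"] elim by (simp add: N_scale)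
    finally show ?case
      using elim by (simp add: field_simps)
  qed
  then have "dN x v \<le> N (x + v) - N x"
    by (rule tendsto_upperbound[OF quotient_tendsto_dN[OF assms]]) simp
  then show ?thesis by simp
qed

lemma dN_le:
  assumes "x \<noteq> 0"
  shows "dN x v \<le> N v"
  using subgradient[OF assms, of v] N_triangle[of x v] by simp

text \<open>This form of tangency mentions no derivative, so it passes to limits in \<open>x\<close>
  by continuity of \<open>N\<close> alone.\<close>

lemma dN_eq_0_iff_min:
  assumes "x \<noteq> 0"
  shows "dN x v = 0 \<longleftrightarrow> (\<forall>t. N x \<le> N (x + t *\<^sub>R v))"
proof
  assume "dN x v = 0"
  then show "\<forall>t. N x \<le> N (x + t *\<^sub>R v)"
    using subgradient[OF assms, of "_ *\<^sub>R v"] by (simp add: dN_linear(3)[OF assms])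
next
  assume *: "\<forall>t. N x \<le> N (x + t *\<^sub>R v)"
  show "dN x v = 0"
    by (rule DERIV_local_min[OF has_real_derivative_N_line[OF assms], of 1]) (use * in auto)
qed

end

text \<open>The field \<open>A\<close> is also tangent to the level sets of the quadratic form \<open>q x = det (x, A x)\<close>,
  provided that \<open>A\<close> has trace \<open>0\<close>; the trace vanishes because \<open>N\<^sup>2 / q\<close> is homogeneous of degree \<open>0\<close>
  and so has a critical point. As \<open>x\<close> and \<open>A x\<close> span the plane, \<open>N\<^sup>2 / q\<close> is then constant.\<close>

lemma (in plane_norm) euclidean_if_tangent_linear_field:
  assumes A: "linear A" and inj: "\<And>x. A x = 0 \<Longrightarrow> x = 0"
    and tangent: "\<And>x. x \<noteq> 0 \<Longrightarrow> dN x (A x) = 0"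
  shows "euclidean_norm N"
proof -
  \<comment> \<open>This is \<open>det (x, A y)\<close>. Up to a scalar factor it will be the inner
    product; it turns out symmetric once the trace of \<open>A\<close> is known to be 0.\<close>
  define b where "b x y = x$1 * A y$2 - x$2 * A y$1" for x y :: "real^2"
  define q where "q x = b x x" for x
  define a11 a12 a21 a22 where a_def:
    "a11 = A (axis 1 1) $ 1" "a12 = A (axis 2 1) $ 1" "a21 = A (axis 1 1) $ 2" "a22 = A (axis 2 1) $ 2"
  define tr where "tr = a11 + a22"
  have A_eq: "A x $ 1 = a11 * x$1 + a12 * x$2" "A x $ 2 = a21 * x$1 + a22 * x$2" for x :: "real^2"
  proof -
    have "x = x$1 *\<^sub>R axis 1 1 + x$2 *\<^sub>R axis 2 1"
      by (simp add: vec_eq_iff forall_2 axis_def)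
    then have "A x = A (x$1 *\<^sub>R axis 1 1 + x$2 *\<^sub>R axis 2 1)"
      by (rule arg_cong)
    then show "A x $ 1 = a11 * x$1 + a12 * x$2" "A x $ 2 = a21 * x$1 + a22 * x$2"
      by (simp_all add: a_def linear_add[OF A] linear_cmul[OF A])
  qed
  \<comment> \<open>Cayley-Hamilton: \<open>A (A x)\<close> is \<open>tr\<close> times
    \<open>A x\<close> minus a multiple of \<open>x\<close>, and
    \<open>det (x, x) = 0\<close>.\<close>
  have bA: "b x (A x) = tr * q x" for x
    unfolding b_def q_def tr_def A_eq by (simp add: algebra_simps)
  have bilin: "bilinear b"
    unfolding bilinear_def b_def
    by (auto intro!: linearI simp: linear_add[OF A] linear_cmul[OF A] algebra_simps)
  have q_nz: "q x \<noteq> 0" if "x \<noteq> 0" for x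
  proof
    assume "q x = 0"
    \<comment> \<open>A vanishing determinant makes \<open>A x\<close> parallel to \<open>x\<close>;
      tangency and Euler's relation then force the factor to be 0.\<close>
    have "\<exists>c. A x = c *\<^sub>R x"
    proof (cases "x$1 = 0")
      case True
      then have "x$2 \<noteq> 0" using that by (simp add: vec_eq_iff forall_2)
      then show ?thesis using \<open>q x = 0\<close> True
        by (intro exI[of _ "A x $ 2 / x $ 2"]) (simp add: vec_eq_iff forall_2 q_def b_def field_simps)
    next
      case False
      then show ?thesis using \<open>q x = 0\<close>
        by (intro exI[of _ "A x $ 1 / x $ 1"]) (simp add: vec_eq_iff forall_2 q_def b_def field_simps)
    qed
    then obtain c where c: "A x = c *\<^sub>R x" ..
    then have "c * N x = 0"
      using tangent[OF that] dN_self[OF that] dN_linear(3)[OF that] by simp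
    then have "A x = 0" using c N_eq_0[of x] that by auto
    then show False using inj that by blast
  qed
  have dq: "(q has_derivative (\<lambda>v. b v x + b x v)) (at x)" for x
  proof -
    have "bounded_bilinear b"
      using bilin bilinear_conv_bounded_bilinear by blast
    from bounded_bilinear.FDERIV[OF this has_derivative_ident has_derivative_ident, of x UNIV]
    show ?thesis unfolding q_def by (simp add: add.commute)
  qed
  define G where "G x = (N x)\<^sup>2 / q x" for x
  define dG where "dG x v = (2 * N x * dN x v * q x - (N x)\<^sup>2 * (b v x + b x v)) / (q x)\<^sup>2" for x v
  have dG: "(G has_derivative dG x) (at x)" if "x \<noteq> 0" for x
    unfolding G_def
    by (rule has_derivative_eq_rhs[OF has_derivative_divide'[OF
          has_derivative_power[OF has_derivative_N[OF that], of 2] dq q_nz[OF that]]])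
      (simp add: fun_eq_iff dG_def power2_eq_square)
  have G_scale: "G (c *\<^sub>R x) = G x" if "c \<noteq> 0" for c x
  proof -
    have "q (c *\<^sub>R x) = c\<^sup>2 * q x"
      unfolding q_def bilinear_lmul[OF bilin] bilinear_rmul[OF bilin] by (simp add: power2_eq_square)
    then show ?thesis
      using that unfolding G_def N_scale by (simp add: power_mult_distrib)
  qed
  \<comment> \<open>A maximum on the compact Euclidean sphere is, by \<open>G_scale\<close>, a
    maximum over all nonzero vectors, hence a critical point.\<close>
  have "\<exists>x\<in>sphere 0 1. \<forall>y\<in>sphere 0 1. G y \<le> G x"
  proof (rule continuous_attains_sup)
    have "isCont G x" if "x \<in> sphere 0 1" for x
      using that by (intro has_derivative_continuous[OF dG]) auto
    then show "continuous_on (sphere 0 1) G"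
      by (simp add: continuous_at_imp_continuous_on)
  qed simp_all
  then obtain x0 where x0: "norm x0 = 1" "\<And>y. norm y = 1 \<Longrightarrow> G y \<le> G x0" by auto
  have x0_max: "G y \<le> G x0" if "y \<noteq> 0" for y
    using x0(2)[of "(1 / norm y) *\<^sub>R y"] G_scale[of "1 / norm y" y] that by simp
  have "x0 \<noteq> 0" using x0 by auto
  have "dG x0 = (\<lambda>v. 0)"
    by (rule differential_zero_maxmin[of x0 "- {0}" G])
      (use dG[OF \<open>x0 \<noteq> 0\<close>] x0_max \<open>x0 \<noteq> 0\<close> in auto)
  then have "dG x0 (A x0) = 0" by simp
  \<comment> \<open>Along \<open>A x\<close> the form \<open>q\<close> changes at rate
    \<open>tr * q x\<close> while \<open>N\<close> is stationary; at the critical point this leaves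
    only \<open>tr = 0\<close>.\<close>
  moreover have "b (A x) x + b x (A x) = tr * q x" for x
    unfolding bA by (simp add: b_def)
  ultimately have "tr = 0"
    using tangent[OF \<open>x0 \<noteq> 0\<close>] q_nz[OF \<open>x0 \<noteq> 0\<close>] \<open>x0 \<noteq> 0\<close> by (auto simp: dG_def N_eq_0)
  have sym: "b x y = b y x" for x y
    using \<open>tr = 0\<close> unfolding b_def tr_def A_eq by algebra
  have dG0: "dG x v = 0" if "x \<noteq> 0" for x v
  proof -
    have lin: "linear (dG x)" using dG[OF that] has_derivative_linear by blast
    have "dG x x = 0"
      using dN_self[OF that] by (simp add: dG_def q_def power2_eq_square)
    moreover have "dG x (A x) = 0"
      using tangent[OF that] \<open>tr = 0\<close> bA[of x] sym[of "A x" x] by (simp add: dG_def)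
    \<comment> \<open>Cramer's rule in the basis \<open>x\<close>, \<open>A x\<close>.\<close>
    moreover have "q x *\<^sub>R v = b v x *\<^sub>R x + (x$1 * v$2 - x$2 * v$1) *\<^sub>R A x"
      by (simp add: vec_eq_iff forall_2 b_def q_def algebra_simps)
    ultimately have "dG x (q x *\<^sub>R v) = 0"
      by (simp add: linear_add[OF lin] linear_cmul[OF lin])
    then show ?thesis
      using q_nz[OF that] by (simp add: linear_cmul[OF lin])
  qed
  have conn: "connected (- {0::real^2})"
    by (rule connected_punctured_universe) simp
  define e :: "real^2" where "e = axis 1 1"
  have "e \<noteq> 0" by (simp add: e_def axis_eq_0_iff)
  have G_const: "G x = G e" if "x \<noteq> 0" for x
  proof (rule has_derivative_zero_unique_connected[of "- {0}" G x e])
    show "(G has_derivative (\<lambda>h. 0)) (at y)" if "y \<in> - {0}" for y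
      using dG[of y] dG0[of y] that by (metis ComplD ext singletonI)
  qed (use conn that \<open>e \<noteq> 0\<close> in auto)
  have N2: "(N x)\<^sup>2 = G e * b x x" for x
  proof (cases "x = 0")
    case True
    then show ?thesis using N_eq_0[of 0] bilinear_lzero[OF bilin] by simp
  next
    case False
    then show ?thesis using G_const[OF False] q_nz[OF False] by (simp add: G_def q_def field_simps)
  qed
  \<comment> \<open>\<open>q\<close> may be negative definite; \<open>G e\<close> then has the same
    sign, and positivity of the product is read off from \<open>N2\<close>.\<close>
  have "inner_product (\<lambda>x y. G e * b x y)"
    unfolding inner_product_def
  proof (intro conjI allI impI)
    show "bilinear (\<lambda>x y. G e * b x y)"
      unfolding bilinear_def
      by (auto intro!: linearI simp: bilinear_ladd[OF bilin] bilinear_radd[OF bilin]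
          bilinear_lmul[OF bilin] bilinear_rmul[OF bilin] algebra_simps)
    show "G e * b x x > 0" if "x \<noteq> 0" for x
      using zero_less_power[OF N_pos[OF that], of 2] by (simp only: N2)
  qed (simp add: sym)
  moreover have "N x = sqrt (G e * b x x)" for x
    by (simp add: N_nonneg flip: N2)
  ultimately show ?thesis unfolding euclidean_norm_def by blast
qed

section \<open>Potentials on the doubled complete bipartite graph\<close>

lemma finite_K2_edges: "finite (K2_edges m n)"
proof -
  have "finite (UNIV :: colour set)"
    by (rule finite_subset[of _ "{Blue, Red}"]) (use colour.exhaust in auto)
  then show ?thesis unfolding K2_edges_def by simp
qed

lemma graph_vertices_K2_edges: "E \<subseteq> K2_edges m n \<Longrightarrow> graph_vertices E \<subseteq> K2_vertices m n"
  unfolding graph_vertices_def K2_edges_def K2_vertices_def by fastforce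

lemma sum_ends:
  fixes g :: "nat + nat \<Rightarrow> real"
  assumes "ends e = {u, v}"
  shows "sum g (ends e) = g u + g v"
proof -
  have "u \<noteq> v" using assms by (cases e) (auto simp: doubleton_eq_iff)
  then show ?thesis unfolding assms by simp
qed

section \<open>Components and paths\<close>

lemma adjacency_sym: "(x, y) \<in> adjacency E \<Longrightarrow> (y, x) \<in> adjacency E"
  unfolding adjacency_def by (auto simp: insert_commute)

lemma adjacency_rtrancl_sym: "(x, y) \<in> (adjacency E)\<^sup>* \<Longrightarrow> (y, x) \<in> (adjacency E)\<^sup>*"
  using sym_rtrancl[of "adjacency E"] adjacency_sym by (auto simp: sym_def)

lemma adjacency_isl: "(x, y) \<in> adjacency E \<Longrightarrow> isl x \<noteq> isl y"
  unfolding adjacency_def by (fastforce simp: doubleton_eq_iff)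

lemma edge_within_or_outside_component:
  assumes "(i, k, c) \<in> E"
  shows "Inl i \<in> (adjacency E)\<^sup>* `` {v} \<longleftrightarrow> Inr k \<in> (adjacency E)\<^sup>* `` {v}"
proof -
  have "(Inl i, Inr k) \<in> adjacency E"
    unfolding adjacency_def using assms by (auto intro!: bexI[of _ "(i, k, c)"])
  then show ?thesis
    using adjacency_sym by (meson Image_singleton_iff rtrancl.rtrancl_into_rtrancl)
qed

text \<open>A new vertex is appended to the path, unless the path has met it already; then the path
  is cut off there.\<close>

lemma rtrancl_imp_distinct_path:
  assumes "(x, y) \<in> R\<^sup>*"
  shows "\<exists>vs. vs \<noteq> [] \<and> hd vs = x \<and> last vs = y \<and> distinct vs \<and>
    (\<forall>i. Suc i < length vs \<longrightarrow> (vs ! i, vs ! Suc i) \<in> R)"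
  using assms
proof (induction rule: rtrancl_induct)
  case base
  show ?case by (intro exI[of _ "[x]"]) auto
next
  case (step y z)
  then obtain vs where vs: "vs \<noteq> []" "hd vs = x" "last vs = y" "distinct vs"
    "\<And>i. Suc i < length vs \<Longrightarrow> (vs ! i, vs ! Suc i) \<in> R" by blast
  show ?case
  proof (cases "z \<in> set vs")
    case True
    then obtain k where k: "k < length vs" "vs ! k = z" by (auto simp: in_set_conv_nth)
    then have "last (take (Suc k) vs) = z" by (simp add: take_Suc_conv_app_nth)
    then show ?thesis using vs k
      by (intro exI[of _ "take (Suc k) vs"]) auto
  next
    case False
    have "((vs @ [z]) ! i, (vs @ [z]) ! Suc i) \<in> R" if "Suc i < length (vs @ [z])" for i
    proof (cases "Suc i < length vs")
      case False
      then have "i = length vs - 1" using that by simp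
      then show ?thesis using vs step.hyps by (simp add: nth_append last_conv_nth)
    qed (use vs in \<open>simp add: nth_append\<close>)
    then show ?thesis using vs False by (intro exI[of _ "vs @ [z]"]) auto
  qed
qed

section \<open>Alternating sums around cycles\<close>

lemma alternating_sum_telescope:
  "(\<Sum>j<l. (- 1) ^ j * (h j + h (Suc j))) = h 0 - (- 1) ^ l * (h l :: real)"
  by (induction l) (auto simp: algebra_simps)

text \<open>Each vertex of the cycle is shared by two consecutive edges, which carry opposite signs;
  evenness of the length makes this hold where the cycle closes.\<close>

lemma cycle_alternating_sum_ends:
  fixes g :: "nat + nat \<Rightarrow> real"
  assumes "is_cycle E es"
  shows "(\<Sum>j<length es. (- 1) ^ j * sum g (ends (es ! j))) = 0"
proof -
  obtain vs where vs: "length vs = length es"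
    "\<And>j. j < length es \<Longrightarrow> ends (es ! j) = {vs ! j, vs ! (Suc j mod length es)}"
    and es: "even (length es)"
    using assms unfolding is_cycle_def by blast
  define h where "h j = g (vs ! (j mod length es))" for j
  have "(\<Sum>j<length es. (- 1) ^ j * sum g (ends (es ! j))) =
      (\<Sum>j<length es. (- 1) ^ j * (h j + h (Suc j)))"
    by (intro sum.cong) (auto simp: h_def sum_ends[OF vs(2)])
  also have "\<dots> = 0"
    unfolding alternating_sum_telescope using es by (simp add: h_def)
  finally show ?thesis .
qed

text \<open>The weight is the constant \<open>r Red\<close> plus \<open>r Blue - r Red\<close> on
  blue edges. Over an even length the constant cancels, so for distinct weights the sum vanishes
  exactly on dependent cycles.\<close>

lemma alternating_sum_colours:
  fixes r :: "colour \<Rightarrow> real"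
  assumes "even (length es)"
  shows "(\<Sum>j<length es. (- 1) ^ j * r (colour_of (es ! j))) =
    (r Blue - r Red) *
      (real (card {i. i < length es \<and> even i \<and> colour_of (es ! i) = Blue}) -
       real (card {i. i < length es \<and> odd i \<and> colour_of (es ! i) = Blue}))"
proof -
  let ?l = "length es" and ?blue = "\<lambda>j. colour_of (es ! j) = Blue"
  have count: "(\<Sum>j<?l. of_bool (P j)) = real (card {j. j < ?l \<and> P j})" for P
  proof -
    have "{..<?l} \<inter> {j. P j} = {j. j < ?l \<and> P j}" by auto
    then show ?thesis by (simp add: of_bool_def sum.If_cases)
  qed
  have "(\<Sum>j<?l. (- 1) ^ j * r (colour_of (es ! j))) =
      (\<Sum>j<?l. r Red * (- 1) ^ j +
        (r Blue - r Red) * (of_bool (even j \<and> ?blue j) - of_bool (odd j \<and> ?blue j)))"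
  proof (intro sum.cong refl)
    fix j
    show "(- 1) ^ j * r (colour_of (es ! j)) = r Red * (- 1) ^ j +
        (r Blue - r Red) * (of_bool (even j \<and> ?blue j) - of_bool (odd j \<and> ?blue j))"
      by (cases "even j"; cases "colour_of (es ! j)") (auto simp: algebra_simps)
  qed
  also have "\<dots> = r Red * (\<Sum>j<?l. (- 1) ^ j) + (r Blue - r Red) *
      ((\<Sum>j<?l. of_bool (even j \<and> ?blue j)) - (\<Sum>j<?l. of_bool (odd j \<and> ?blue j)))"
    by (simp only: sum.distrib sum_subtractf flip: sum_distrib_left)
  also have "(\<Sum>j<?l. (- 1) ^ j) = (0 :: real)"
    \<comment> \<open>With the constant 1/2, each bracket \<open>h j + h (Suc j)\<close> is
      1.\<close>
    using alternating_sum_telescope[of "\<lambda>_. 1 / 2" ?l] assms by simp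
  finally show ?thesis by (simp only: count mult_zero_right add_0)
qed

text \<open>A path from a column to a row has an odd number of edges, so adding \<open>e\<close>
  gives even length. If the path is a single edge, it differs from \<open>e\<close> by colour and
  the cycle has length 2.\<close>

lemma closing_path_is_cycle:
  assumes e: "e = (i, k, c)" "e \<notin> F" and path: "(Inl i, Inr k) \<in> (adjacency F)\<^sup>*"
  obtains es where "is_cycle (insert e F) es" "last es = e" "set (butlast es) \<subseteq> F"
proof -
  obtain vs where vs: "vs \<noteq> []" "hd vs = Inl i" "last vs = Inr k" "distinct vs"
    and adj: "\<And>j. Suc j < length vs \<Longrightarrow> (vs ! j, vs ! Suc j) \<in> adjacency F"
    using rtrancl_imp_distinct_path[OF path] by blast
  obtain l where l: "length vs = Suc l" using vs(1) by (cases vs) auto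
  have "\<forall>j. \<exists>f. j < l \<longrightarrow> f \<in> F \<and> ends f = {vs ! j, vs ! Suc j}"
    using adj l unfolding adjacency_def by fastforce
  then obtain f where f: "\<And>j. j < l \<Longrightarrow> f j \<in> F" "\<And>j. j < l \<Longrightarrow> ends (f j) = {vs ! j, vs ! Suc j}"
    by metis
  define es where "es = map f [0..<l] @ [e]"
  \<comment> \<open>Columns and rows alternate; the path ends at a row, whence \<open>l\<close> is
    odd.\<close>
  have isl: "isl (vs ! j) \<longleftrightarrow> even j" if "j \<le> l" for j
    using that
  proof (induction j)
    case 0
    show ?case using vs by (simp add: hd_conv_nth[symmetric])
  next
    case (Suc j)
    then show ?case using adjacency_isl[OF adj[of j]] l by auto
  qed
  have last: "vs ! l = Inr k" using vs l by (simp add: last_conv_nth)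
  have "odd l" using isl[of l] last by simp
  \<comment> \<open>The first vertex of an edge of the path is on no later edge, because the
    vertices are distinct.\<close>
  have "inj_on f {0..<l}"
  proof (rule linorder_inj_onI)
    fix p q assume "p < q" "p \<in> {0..<l}" "q \<in> {0..<l}"
    then have "vs ! p \<notin> {vs ! q, vs ! Suc q}"
      using vs(4) l by (auto simp: nth_eq_iff_index_eq)
    then show "f p \<noteq> f q"
      using f(2)[of p] f(2)[of q] \<open>p < q\<close> \<open>q \<in> {0..<l}\<close> by auto
  qed auto
  then have "distinct es"
    unfolding es_def using f(1) e(2) by (auto simp: distinct_map)
  moreover have "ends (es ! j) = {vs ! j, vs ! (Suc j mod length es)}" if "j < length es" for j
  proof (cases "j < l")
    case True
    then show ?thesis using f(2) by (simp add: es_def nth_append)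
  next
    case False
    then have "j = l" using that by (simp add: es_def)
    moreover have "vs ! 0 = Inl i" using vs by (simp add: hd_conv_nth)
    ultimately show ?thesis using last e(1) by (auto simp: es_def nth_append)
  qed
  ultimately have cycle: "is_cycle (insert e F) es"
    unfolding is_cycle_def using \<open>odd l\<close> f(1) vs(4) l
    by (intro conjI exI[of _ vs]) (auto simp: es_def)
  have "set (butlast es) \<subseteq> F" "last es = e"
    using f(1) by (auto simp: es_def)
  then show ?thesis
    using that[OF cycle] by blast
qed

text \<open>A new edge either joins two components, one of which can be shifted in a way that preserves
  all sums over edges, or closes a cycle; in that case the equation for the new edge is implied by
  the others.\<close>

lemma edge_potential_exists:
  fixes r :: "colour \<Rightarrow> real"
  assumes "finite E" and "\<And>es. is_cycle E es \<Longrightarrow> \<not> independent_cycle es"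
  shows "\<exists>g. \<forall>e\<in>E. sum g (ends e) = r (colour_of e)"
  using assms
proof (induction E rule: finite_induct)
  case empty
  show ?case by simp
next
  case (insert e F)
  have "is_cycle F es \<Longrightarrow> is_cycle (insert e F) es" for es
    unfolding is_cycle_def by blast
  then obtain g where g: "\<And>f. f \<in> F \<Longrightarrow> sum g (ends f) = r (colour_of f)"
    using insert.IH insert.prems by meson
  obtain i k c where e: "e = (i, k, c)" by (cases e)
  show ?case
  proof (cases "(Inl i, Inr k) \<in> (adjacency F)\<^sup>*")
    case True
    then obtain es where es: "is_cycle (insert e F) es" "last es = e" "set (butlast es) \<subseteq> F"
      using closing_path_is_cycle[OF e insert.hyps(2)] by metis
    \<comment> \<open>The signed defect of the equation of edge \<open>j\<close>. The defects add up
      to 0 because the cycle is dependent, and all but the last vanish by the choice of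
      \<open>g\<close>.\<close>
    define d where "d j = (- 1) ^ j * (sum g (ends (es ! j)) - r (colour_of (es ! j)))" for j
    obtain l where l: "length es = Suc l" and even: "even (length es)"
      using es(1) unfolding is_cycle_def by (cases es) auto
    have es_l: "es ! l = e" using es(2) l last_conv_nth[of es] by fastforce
    have "(\<Sum>j<length es. d j) = 0"
      using cycle_alternating_sum_ends[OF es(1), of g] alternating_sum_colours[OF even, of r]
        insert.prems[OF es(1)] unfolding independent_cycle_def d_def
      by (simp add: right_diff_distrib sum_subtractf)
    moreover have "d j = 0" if "j < l" for j
    proof -
      have "es ! j \<in> set (butlast es)"
        using that l by (metis diff_Suc_1 length_butlast nth_butlast nth_mem)
      then have "es ! j \<in> F" using es(3) by blast
      then show ?thesis using g[of "es ! j"] by (simp add: d_def)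
    qed
    ultimately have "d l = 0" by (simp add: l)
    then have "sum g (ends e) = r (colour_of e)" by (simp add: d_def es_l)
    then show ?thesis using g by blast
  next
    case False
    define C where "C = (adjacency F)\<^sup>* `` {Inr k}"
    define t where "t = r (colour_of e) - sum g (ends e)"
    \<comment> \<open>Inside \<open>C\<close> rows go up by \<open>t\<close> and columns down by
      \<open>t\<close>, so each edge of \<open>F\<close> keeps its sum. Of the ends of
      \<open>e\<close> only the row lies in \<open>C\<close>.\<close>
    define g' where "g' v = (if v \<in> C then g v + (if isl v then - t else t) else g v)" for v
    have "Inl i \<notin> C" using False adjacency_rtrancl_sym unfolding C_def by blast
    moreover have "Inr k \<in> C" unfolding C_def by simp
    ultimately have "sum g' (ends e) = r (colour_of e)"
      by (simp add: e g'_def t_def)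
    moreover have "sum g' (ends f) = r (colour_of f)" if "f \<in> F" for f
    proof -
      obtain i' k' c' where f: "f = (i', k', c')" by (cases f)
      then have "Inl i' \<in> C \<longleftrightarrow> Inr k' \<in> C"
        unfolding C_def using edge_within_or_outside_component that by blast
      then show ?thesis
        using g[OF that] by (auto simp: f g'_def)
    qed
    ultimately show ?thesis by blast
  qed
qed

definition brace_solution :: "(colour \<Rightarrow> real) \<Rightarrow> bedge set \<Rightarrow> (nat + nat \<Rightarrow> real) \<Rightarrow> bool" where
  "brace_solution w E x \<longleftrightarrow> (\<forall>(i, k, c)\<in>E. x (Inr k) = w c * x (Inl i))"

text \<open>A solution that vanishes at one vertex vanishes on its component. On a component where it does
  not vanish, \<open>ln \<bar>x\<bar>\<close>, negated at the columns, is a potential of the edge weights \<open>ln w\<close>, and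
  such a potential exists iff the alternating sum of the weights vanishes on each cycle.\<close>

lemma only_zero_brace_solution_iff:
  assumes w: "\<And>c. w c > 0" "w Blue \<noteq> w Red" and E: "E \<subseteq> K2_edges m n"
  shows "(\<forall>x. brace_solution w E x \<longrightarrow> (\<forall>v\<in>K2_vertices m n. x v = 0)) \<longleftrightarrow>
    spanning m n E \<and> independent_cycle_in_each_component E"
proof (intro iffI conjI)
  assume only_zero: "\<forall>x. brace_solution w E x \<longrightarrow> (\<forall>v\<in>K2_vertices m n. x v = 0)"
  show "spanning m n E"
    unfolding spanning_def
  proof
    fix v assume v: "v \<in> K2_vertices m n"
    show "v \<in> graph_vertices E"
    proof (rule ccontr)
      assume "v \<notin> graph_vertices E"
      \<comment> \<open>No equation involves an isolated vertex, so its indicator is a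
        solution.\<close>
      then have "brace_solution w E (\<lambda>u. of_bool (u = v))"
        unfolding brace_solution_def graph_vertices_def by fastforce
      then show False using only_zero v by fastforce
    qed
  qed
  show "independent_cycle_in_each_component E"
    unfolding independent_cycle_in_each_component_def
  proof (rule ballI, rule ccontr)
    fix C assume C: "C \<in> components E"
      and none: "\<nexists>es. is_cycle E es \<and> independent_cycle es \<and> (\<forall>e\<in>set es. ends e \<subseteq> C)"
    obtain v where v: "v \<in> graph_vertices E" "C = (adjacency E)\<^sup>* `` {v}"
      using C unfolding components_def by blast
    define EC where "EC = {e \<in> E. ends e \<subseteq> C}"
    have "finite EC"
      unfolding EC_def using finite_subset[OF E finite_K2_edges] by simp
    moreover have "\<not> independent_cycle es" if "is_cycle EC es" for es
    proof -
      have "is_cycle E es" "\<forall>e\<in>set es. ends e \<subseteq> C"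
        using that unfolding is_cycle_def EC_def by auto
      then show ?thesis using none by blast
    qed
    ultimately obtain g where g: "\<And>e. e \<in> EC \<Longrightarrow> sum g (ends e) = ln (w (colour_of e))"
      using edge_potential_exists[of EC "\<lambda>c. ln (w c)"] by blast
    \<comment> \<open>Extending by 0 outside \<open>C\<close> is harmless because no edge leaves a
      component.\<close>
    define x where "x u = (if u \<in> C then exp (if isl u then - g u else g u) else 0)" for u
    have "x (Inr k) = w c * x (Inl i)" if e: "(i, k, c) \<in> E" for i k c
    proof (cases "Inl i \<in> C")
      case True
      moreover from True have "Inr k \<in> C" using edge_within_or_outside_component[OF e] v(2) by blast
      ultimately have "g (Inl i) + g (Inr k) = ln (w c)"
        using g[of "(i, k, c)"] e by (simp add: EC_def colour_of_def)
      then have "w c = exp (g (Inl i) + g (Inr k))" using w(1)[of c] by simp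
      then show ?thesis using True \<open>Inr k \<in> C\<close> by (simp add: x_def flip: exp_add)
    next
      case False
      then have "Inr k \<notin> C" using edge_within_or_outside_component[OF e] v(2) by blast
      then show ?thesis using False by (simp add: x_def)
    qed
    then have "brace_solution w E x" unfolding brace_solution_def by blast
    moreover have "v \<in> K2_vertices m n" using v graph_vertices_K2_edges[OF E] by blast
    moreover have "x v \<noteq> 0" using v by (simp add: x_def)
    ultimately show False using only_zero by blast
  qed
next
  assume graph: "spanning m n E \<and> independent_cycle_in_each_component E"
  show "\<forall>x. brace_solution w E x \<longrightarrow> (\<forall>v\<in>K2_vertices m n. x v = 0)"
  proof (intro allI impI ballI, rule ccontr)
    fix x v assume x: "brace_solution w E x" and v: "v \<in> K2_vertices m n" "x v \<noteq> 0"
    define C where "C = (adjacency E)\<^sup>* `` {v}"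
    have "C \<in> components E"
      unfolding components_def C_def using graph v unfolding spanning_def by blast
    then obtain es where es: "is_cycle E es" "independent_cycle es" "\<And>e. e \<in> set es \<Longrightarrow> ends e \<subseteq> C"
      using graph unfolding independent_cycle_in_each_component_def by blast
    have nz: "x u \<noteq> 0" if "u \<in> C" for u
    proof -
      have "(v, u) \<in> (adjacency E)\<^sup>*" using that by (simp add: C_def)
      then show ?thesis
      proof (induction rule: rtrancl_induct)
        case base
        show ?case by fact
      next
        case (step y z)
        then obtain i k c where e: "(i, k, c) \<in> E" "{Inl i, Inr k} = {y, z}"
          unfolding adjacency_def by auto
        then have "x (Inr k) = w c * x (Inl i)" using x unfolding brace_solution_def by blast
        then show ?case using e(2) step.IH w(1)[of c] by (auto simp: doubleton_eq_iff)
      qed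
    qed
    define g where "g u = (if isl u then - ln \<bar>x u\<bar> else ln \<bar>x u\<bar>)" for u
    have g: "sum g (ends e) = ln (w (colour_of e))" if "e \<in> set es" for e
    proof -
      obtain i k c where e: "e = (i, k, c)" by (cases e)
      have "e \<in> E" using es(1) that unfolding is_cycle_def by blast
      then have "x (Inr k) = w c * x (Inl i)" using x e unfolding brace_solution_def by blast
      moreover have "x (Inl i) \<noteq> 0" using es(3)[OF that] e nz by simp
      ultimately show ?thesis
        using w(1)[of c] by (simp add: e g_def abs_mult ln_mult colour_of_def)
    qed
    have "(\<Sum>j<length es. (- 1) ^ j * ln (w (colour_of (es ! j)))) =
        (\<Sum>j<length es. (- 1) ^ j * sum g (ends (es ! j)))"
      by (intro sum.cong) (auto simp: g)
    also have "\<dots> = 0" by (rule cycle_alternating_sum_ends[OF es(1)])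
    \<comment> \<open>Independence makes the difference of the blue counts nonzero, so the other
      factor vanishes.\<close>
    finally have "ln (w Blue) = ln (w Red)"
      using alternating_sum_colours[of es "\<lambda>c. ln (w c)"] es(1,2)
      unfolding is_cycle_def independent_cycle_def by simp
    then show False using w by simp
  qed
qed

section \<open>Flexes of grids\<close>

context plane_norm
begin

lemma dN_minus_eq_0_iff:
  assumes "x \<noteq> 0"
  shows "dN (- x) (- v) = 0 \<longleftrightarrow> dN x v = 0"
proof -
  have "N (- x + t *\<^sub>R (- v)) = N (x + t *\<^sub>R v)" for t
    using N_minus[of "x + t *\<^sub>R v"] by simp
  then show ?thesis
    using assms by (simp add: dN_eq_0_iff_min N_minus)
qed

text \<open>In case of equality the normalised \<open>x\<close> and \<open>v\<close> both lie on the
  supporting line \<open>dN x = 1\<close> of the unit ball. So does their midpoint, whose norm is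
  below 1 by strict convexity, against \<open>dN_le\<close>.\<close>

lemma dN_less:
  assumes strict: "strictly_convex_norm N" and "x \<noteq> 0" and indep: "\<And>c. v \<noteq> c *\<^sub>R x"
  shows "dN x v < N v"
proof (rule ccontr)
  assume "\<not> dN x v < N v"
  then have eq: "dN x v = N v" using dN_le[OF \<open>x \<noteq> 0\<close>, of v] by simp
  have "v \<noteq> 0" using indep[of 0] by simp
  define x' v' where "x' = (1 / N x) *\<^sub>R x" and "v' = (1 / N v) *\<^sub>R v"
  have pos: "N x > 0" "N v > 0" using N_pos \<open>x \<noteq> 0\<close> \<open>v \<noteq> 0\<close> by auto
  have "N x' = 1" "N v' = 1" using pos by (simp_all add: x'_def v'_def N_scale)
  moreover have "x' \<noteq> v'"
  proof
    assume "x' = v'"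
    then have "N v *\<^sub>R x' = N v *\<^sub>R v'" by simp
    then have "v = (N v / N x) *\<^sub>R x" using pos by (simp add: x'_def v'_def)
    then show False using indep by blast
  qed
  ultimately have "N ((1 - 1/2) *\<^sub>R x' + (1/2) *\<^sub>R v') < 1"
    using strict[unfolded strictly_convex_norm_def, rule_format, of x' v' "1/2"] by simp
  moreover have "dN x ((1 - 1/2) *\<^sub>R x' + (1/2) *\<^sub>R v') = 1"
    using pos eq dN_self[OF \<open>x \<noteq> 0\<close>] unfolding x'_def v'_def
    by (simp add: dN_linear[OF \<open>x \<noteq> 0\<close>])
  ultimately show False
    using dN_le[OF \<open>x \<noteq> 0\<close>] by (metis leD)
qed

text \<open>The projection onto the tangent direction at \<open>x\<close>, the kernel of
  \<open>dN x\<close>, along \<open>x\<close>.\<close>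

definition proj_ker :: "real^2 \<Rightarrow> real^2 \<Rightarrow> real^2" where
  "proj_ker x y = y - (dN x y / N x) *\<^sub>R x"

lemma dN_proj_ker: "x \<noteq> 0 \<Longrightarrow> dN x (proj_ker x y) = 0"
  using N_pos[of x] by (simp add: proj_ker_def dN_linear dN_self)

lemma proj_ker_combination:
  "x \<noteq> 0 \<Longrightarrow> proj_ker x (s *\<^sub>R x + t *\<^sub>R y) = t *\<^sub>R proj_ker x y"
  using N_pos[of x] by (simp add: proj_ker_def dN_linear dN_self algebra_simps add_divide_distrib)

lemma proj_ker_fixed: "dN x v = 0 \<Longrightarrow> proj_ker x v = v"
  by (simp add: proj_ker_def)

text \<open>The value is \<open>N y - dN x y * dN y x / N x\<close>. Strict convexity, applied with
  both signs, gives absolute values of \<open>dN x y\<close> and \<open>dN y x\<close> strictly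
  below \<open>N y\<close> and \<open>N x\<close>.\<close>

lemma dN_proj_ker_pos:
  assumes strict: "strictly_convex_norm N" and "x \<noteq> 0" and indep: "\<And>c. y \<noteq> c *\<^sub>R x"
  shows "dN y (proj_ker x y) > 0"
proof -
  have "y \<noteq> 0" using indep[of 0] by simp
  have "- y \<noteq> c *\<^sub>R x" for c using indep[of "- c"] by (metis add.inverse_inverse scaleR_minus_left)
  then have "dN x (- y) < N (- y)" using dN_less[OF strict \<open>x \<noteq> 0\<close>] by blast
  then have 1: "\<bar>dN x y\<bar> < N y"
    using dN_less[OF strict \<open>x \<noteq> 0\<close> indep] linear_dN[OF \<open>x \<noteq> 0\<close>]
    by (simp add: linear_neg N_minus)
  have "x \<noteq> c *\<^sub>R y" for c
  proof
    assume "x = c *\<^sub>R y"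
    then have "y = (1 / c) *\<^sub>R x" using \<open>x \<noteq> 0\<close> by simp
    then show False using indep by blast
  qed
  moreover from this have "- x \<noteq> c *\<^sub>R y" for c by (metis add.inverse_inverse scaleR_minus_left)
  ultimately have "dN y x < N x" "dN y (- x) < N (- x)"
    using dN_less[OF strict \<open>y \<noteq> 0\<close>] by blast+
  then have 2: "\<bar>dN y x\<bar> < N x"
    using linear_dN[OF \<open>y \<noteq> 0\<close>] by (simp add: linear_neg N_minus)
  have "\<bar>dN x y * dN y x\<bar> < N y * N x"
    using mult_strict_mono'[OF 1 2] by (simp add: abs_mult)
  then have "dN x y * dN y x < N y * N x" by linarith
  then show ?thesis
    using N_pos[OF \<open>x \<noteq> 0\<close>]
    by (simp add: proj_ker_def dN_linear[OF \<open>y \<noteq> 0\<close>] dN_self[OF \<open>y \<noteq> 0\<close>] field_simps)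
qed

end

text \<open>\<open>e1\<close> and \<open>e2\<close> are the directions of the grid lines; the
  inclination enters only through this basis.\<close>

locale grid_norm = plane_norm +
  fixes e1 e2 :: "real^2"
  assumes strict: "strictly_convex_norm N"
    and indep: "\<And>s t. s *\<^sub>R e1 + t *\<^sub>R e2 = 0 \<Longrightarrow> s = 0 \<and> t = 0"
    and span: "\<And>x. \<exists>s t. x = s *\<^sub>R e1 + t *\<^sub>R e2"
begin

lemma coordinates_unique:
  "s *\<^sub>R e1 + t *\<^sub>R e2 = s' *\<^sub>R e1 + t' *\<^sub>R e2 \<longleftrightarrow> s = s' \<and> t = t'"
  using indep[of "s - s'" "t - t'"] by (auto simp: algebra_simps)

lemma combination_eq_0: "s *\<^sub>R e1 + t *\<^sub>R e2 = 0 \<longleftrightarrow> s = 0 \<and> t = 0"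
  using indep by auto

lemma e_nonzero: "e1 \<noteq> 0" "e2 \<noteq> 0" "e1 + e2 \<noteq> 0" "e1 - e2 \<noteq> 0"
  using combination_eq_0[of 1 0] combination_eq_0[of 0 1] combination_eq_0[of 1 1]
    combination_eq_0[of 1 "- 1"] by auto

text \<open>\<open>y1\<close> and \<open>y2\<close> span the lines of admissible relative velocities along horizontal and vertical
  bars. The sign of \<open>y2\<close> makes both ratios \<open>w\<close> below positive; in the Euclidean case \<open>y1 = e2\<close> and
  \<open>y2 = - e1\<close>.\<close>

definition y1 where "y1 = proj_ker e1 e2"
definition y2 where "y2 = - proj_ker e2 e1"

text \<open>Projecting \<open>s *\<^sub>R e1 + t *\<^sub>R e2\<close> along \<open>e1\<close> gives
  \<open>t *\<^sub>R y1\<close>, so \<open>dN_proj_ker_pos\<close> fixes the sign of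
  \<open>dN\<close> at this vector on \<open>y1\<close>; likewise for \<open>y2\<close> along
  \<open>e2\<close>.\<close>

lemma dN_y_pos:
  "dN e2 y1 > 0" "dN e1 y2 < 0" "dN (e1 + e2) y1 > 0" "dN (e1 + e2) y2 < 0"
  "dN (e1 - e2) y1 < 0" "dN (e1 - e2) y2 < 0"
proof -
  have not_multiple: "s *\<^sub>R e1 + t *\<^sub>R e2 \<noteq> c *\<^sub>R e1" if "t \<noteq> 0" for s t c
    using that coordinates_unique[of s t c 0] by auto
  have not_multiple': "s *\<^sub>R e1 + t *\<^sub>R e2 \<noteq> c *\<^sub>R e2" if "s \<noteq> 0" for s t c
    using that coordinates_unique[of s t 0 c] by auto
  have y1: "t * dN (s *\<^sub>R e1 + t *\<^sub>R e2) y1 > 0" if "t \<noteq> 0" for s t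
  proof -
    have "s *\<^sub>R e1 + t *\<^sub>R e2 \<noteq> 0" using that combination_eq_0 by auto
    then show ?thesis
      using dN_proj_ker_pos[OF strict e_nonzero(1) not_multiple[OF that], of s]
      by (simp add: proj_ker_combination[OF e_nonzero(1)] y1_def dN_linear)
  qed
  have y2: "s * dN (s *\<^sub>R e1 + t *\<^sub>R e2) y2 < 0" if "s \<noteq> 0" for s t
  proof -
    have nz: "s *\<^sub>R e1 + t *\<^sub>R e2 \<noteq> 0" using that combination_eq_0 by auto
    have "proj_ker e2 (s *\<^sub>R e1 + t *\<^sub>R e2) = (- s) *\<^sub>R y2"
      using proj_ker_combination[OF e_nonzero(2), of t s e1] by (simp add: y2_def add.commute)
    then show ?thesis
      using dN_proj_ker_pos[OF strict e_nonzero(2) not_multiple'[OF that], of t]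
      by (simp add: dN_linear[OF nz] linear_neg[OF linear_dN[OF nz]])
  qed
  show "dN e2 y1 > 0" "dN (e1 + e2) y1 > 0" "dN (e1 - e2) y1 < 0"
    using y1[of 1 0] y1[of 1 1] y1[of "- 1" 1] by simp_all
  show "dN e1 y2 < 0" "dN (e1 + e2) y2 < 0" "dN (e1 - e2) y2 < 0"
    using y2[of 1 0] y2[of 1 1] y2[of 1 "- 1"] by simp_all
qed

text \<open>\<open>dN e1\<close> kills \<open>y1\<close> but not \<open>y2\<close>, and
  \<open>dN e2\<close> kills \<open>y2\<close> but not \<open>y1\<close>.\<close>

lemma y_indep: "s *\<^sub>R y1 + t *\<^sub>R y2 = 0 \<longleftrightarrow> s = 0 \<and> t = 0"
proof
  assume *: "s *\<^sub>R y1 + t *\<^sub>R y2 = 0"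
  have "dN e1 y1 = 0" "dN e2 y2 = 0"
    using dN_proj_ker e_nonzero linear_neg[OF linear_dN[OF e_nonzero(2)]] by (auto simp: y1_def y2_def)
  moreover have "dN e1 (s *\<^sub>R y1 + t *\<^sub>R y2) = 0" "dN e2 (s *\<^sub>R y1 + t *\<^sub>R y2) = 0"
    unfolding * using dN_linear e_nonzero by auto
  ultimately show "s = 0 \<and> t = 0"
    using dN_y_pos by (simp add: dN_linear e_nonzero)
qed simp

lemma y_unique: "s *\<^sub>R y1 + t *\<^sub>R y2 = s' *\<^sub>R y1 + t' *\<^sub>R y2 \<longleftrightarrow> s = s' \<and> t = t'"
  using y_indep[of "s - s'" "t - t'"] by (auto simp: algebra_simps)

lemma dN_e1_eq_0: "dN e1 v = 0 \<longleftrightarrow> (\<exists>s. v = s *\<^sub>R y1)"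
proof
  assume "dN e1 v = 0"
  then have "proj_ker e1 v = v" by (rule proj_ker_fixed)
  then show "\<exists>s. v = s *\<^sub>R y1"
    using span[of v] proj_ker_combination[OF e_nonzero(1)] by (metis y1_def)
next
  assume "\<exists>s. v = s *\<^sub>R y1"
  then show "dN e1 v = 0" using dN_proj_ker[OF e_nonzero(1)] by (auto simp: dN_linear e_nonzero y1_def)
qed

lemma dN_e2_eq_0: "dN e2 v = 0 \<longleftrightarrow> (\<exists>s. v = s *\<^sub>R y2)"
proof
  assume "dN e2 v = 0"
  then have "proj_ker e2 v = v" by (rule proj_ker_fixed)
  moreover obtain s t where "v = t *\<^sub>R e2 + s *\<^sub>R e1" using span[of v] by (metis add.commute)
  ultimately have "v = (- s) *\<^sub>R y2"
    using proj_ker_combination[OF e_nonzero(2), of t s e1] by (simp add: y2_def)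
  then show "\<exists>s. v = s *\<^sub>R y2" by blast
next
  assume "\<exists>s. v = s *\<^sub>R y2"
  then show "dN e2 v = 0" using dN_proj_ker[OF e_nonzero(2)] linear_neg[OF linear_dN[OF e_nonzero(2)]]
    by (auto simp: dN_linear e_nonzero y2_def)
qed

text \<open>Solves the brace condition for the row unknown. The relative velocity along a red brace
  is a difference of multiples of \<open>y1\<close> and \<open>y2\<close>, along a blue one a sum;
  hence the different signs.\<close>

definition brace_ratio :: "colour \<Rightarrow> real" where
  "brace_ratio c = (case c of Blue \<Rightarrow> - dN (e1 + e2) y1 / dN (e1 + e2) y2
    | Red \<Rightarrow> dN (e1 - e2) y1 / dN (e1 - e2) y2)"

lemma brace_ratio_pos: "brace_ratio c > 0"
  using dN_y_pos by (cases c) (auto simp: brace_ratio_def divide_neg_neg divide_pos_neg)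

definition grid_flex :: "nat \<Rightarrow> nat \<Rightarrow> (nat \<times> nat \<Rightarrow> real^2) \<Rightarrow> bool" where
  "grid_flex m n u \<longleftrightarrow>
    (\<forall>i<m. \<forall>k\<le>n. dN e1 (u (Suc i, k) - u (i, k)) = 0) \<and>
    (\<forall>i\<le>m. \<forall>k<n. dN e2 (u (i, Suc k) - u (i, k)) = 0)"

fun brace_flex :: "(nat \<times> nat \<Rightarrow> real^2) \<Rightarrow> bedge \<Rightarrow> bool" where
  "brace_flex u (i, k, Blue) \<longleftrightarrow> dN (e1 + e2) (u (Suc i, Suc k) - u (i, k)) = 0"
| "brace_flex u (i, k, Red) \<longleftrightarrow> dN (e1 - e2) (u (Suc i, k) - u (i, Suc k)) = 0"

text \<open>\<open>x\<close> holds the relative velocities along single bars, so that its index set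
  is the vertex set of the braces graph; joint velocities are its prefix sums.\<close>

definition shear_flex :: "real^2 \<Rightarrow> (nat + nat \<Rightarrow> real) \<Rightarrow> nat \<times> nat \<Rightarrow> real^2" where
  "shear_flex c x = (\<lambda>(i, k). c + (\<Sum>j<i. x (Inl j)) *\<^sub>R y1 + (\<Sum>j<k. x (Inr j)) *\<^sub>R y2)"

lemma grid_flex_shear_flex: "grid_flex m n (shear_flex c x)"
  unfolding grid_flex_def dN_e1_eq_0 dN_e2_eq_0 shear_flex_def
  by (auto simp: algebra_simps)

text \<open>Closing up the four bars of a square shows that its two horizontal bars have the same relative
  velocity, and so have its two vertical bars.\<close>

lemma grid_flex_imp_shear_flex:
  assumes "grid_flex m n u"
  shows "\<exists>x. \<forall>i\<le>m. \<forall>k\<le>n. u (i, k) = shear_flex (u (0, 0)) x (i, k)"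
proof -
  have "\<forall>i k. \<exists>s. i < m \<longrightarrow> k \<le> n \<longrightarrow> u (Suc i, k) - u (i, k) = s *\<^sub>R y1"
    using assms unfolding grid_flex_def dN_e1_eq_0 by blast
  then obtain p where p: "\<And>i k. i < m \<Longrightarrow> k \<le> n \<Longrightarrow> u (Suc i, k) - u (i, k) = p i k *\<^sub>R y1" by metis
  have "\<forall>i k. \<exists>s. i \<le> m \<longrightarrow> k < n \<longrightarrow> u (i, Suc k) - u (i, k) = s *\<^sub>R y2"
    using assms unfolding grid_flex_def dN_e2_eq_0 by blast
  then obtain q where q: "\<And>i k. i \<le> m \<Longrightarrow> k < n \<Longrightarrow> u (i, Suc k) - u (i, k) = q i k *\<^sub>R y2" by metis
  have "p i (Suc k) = p i k" if "i < m" "k < n" for i k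
  proof -
    have "p i k *\<^sub>R y1 + q (Suc i) k *\<^sub>R y2 = p i (Suc k) *\<^sub>R y1 + q i k *\<^sub>R y2"
      using p[of i k] p[of i "Suc k"] q[of i k] q[of "Suc i" k] that by (simp flip: p q)
    then show ?thesis by (simp add: y_unique)
  qed
  then have p0: "p i k = p i 0" if "i < m" "k \<le> n" for i k
    using that by (induction k) auto
  \<comment> \<open>Read off from the bottom row and the left column of bars; the induction climbs
    the left column first and then goes right.\<close>
  define x where "x v = (case v of Inl i \<Rightarrow> p i 0 | Inr k \<Rightarrow> q 0 k)" for v
  have column: "u (0, k) = shear_flex (u (0, 0)) x (0, k)" if "k \<le> n" for k
    using that
  proof (induction k)
    case (Suc k)
    then show ?case using q[of 0 k] by (simp add: shear_flex_def x_def algebra_simps)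
  qed (simp add: shear_flex_def)
  have "u (i, k) = shear_flex (u (0, 0)) x (i, k)" if "i \<le> m" "k \<le> n" for i k
    using that
  proof (induction i)
    case 0
    then show ?case using column by blast
  next
    case (Suc i)
    then show ?case using p[of i k] p0[of i k] by (simp add: shear_flex_def x_def algebra_simps)
  qed
  then show ?thesis by blast
qed

lemma brace_flex_shear_flex: "brace_flex (shear_flex c x) (i, k, col) \<longleftrightarrow> x (Inr k) = brace_ratio col * x (Inl i)"
proof (cases col)
  case Blue
  have *: "shear_flex c x (Suc i, Suc k) - shear_flex c x (i, k) = x (Inl i) *\<^sub>R y1 + x (Inr k) *\<^sub>R y2"
    by (simp add: shear_flex_def algebra_simps)
  show ?thesis
    unfolding Blue brace_flex.simps * using dN_y_pos(4)
    by (auto simp: brace_ratio_def dN_linear e_nonzero field_simps)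
next
  case Red
  have *: "shear_flex c x (Suc i, k) - shear_flex c x (i, Suc k) = x (Inl i) *\<^sub>R y1 - x (Inr k) *\<^sub>R y2"
    by (simp add: shear_flex_def algebra_simps)
  show ?thesis
    unfolding Red brace_flex.simps * using dN_y_pos(6)
    by (auto simp: brace_ratio_def dN_linear[OF e_nonzero(4)] field_simps)
qed

section \<open>From frameworks on the lattice to linear equations\<close>

definition lattice :: "nat \<times> nat \<Rightarrow> real^2" where
  "lattice v = real (fst v) *\<^sub>R e1 + real (snd v) *\<^sub>R e2"

lemma lattice_diff:
  "lattice v - lattice w = (real (fst v) - real (fst w)) *\<^sub>R e1 + (real (snd v) - real (snd w)) *\<^sub>R e2"
  by (simp add: lattice_def algebra_simps)

lemma lattice_diff_nonzero: "v \<noteq> w \<Longrightarrow> lattice v - lattice w \<noteq> 0"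
  unfolding lattice_diff combination_eq_0 by (auto simp: prod_eq_iff)

lemma infinitesimal_flex_iff:
  assumes "bar_joint_framework F" and place: "place F = (\<lambda>v. lattice v + a)"
  shows "infinitesimal_flex N F u \<longleftrightarrow>
    (\<forall>v w. {v, w} \<in> bars F \<longrightarrow> dN (lattice v - lattice w) (u v - u w) = 0)"
proof -
  have "(\<lambda>t. N ((place F v + t *\<^sub>R u v) - (place F w + t *\<^sub>R u w)) - N (place F v - place F w))
      \<in> o[at_right 0](\<lambda>t. t) \<longleftrightarrow> dN (lattice v - lattice w) (u v - u w) = 0" if "{v, w} \<in> bars F" for v w
  proof -
    have "v \<noteq> w" using that assms(1) unfolding bar_joint_framework_def by (auto simp: doubleton_eq_iff)
    have *: "(place F v + t *\<^sub>R u v) - (place F w + t *\<^sub>R u w) =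
        (lattice v - lattice w) + t *\<^sub>R (u v - u w)" for t
      by (simp add: place algebra_simps)
    have **: "place F v - place F w = lattice v - lattice w"
      by (simp add: place)
    show ?thesis unfolding * ** by (rule first_order_flex_iff[OF lattice_diff_nonzero[OF \<open>v \<noteq> w\<close>]])
  qed
  then show ?thesis unfolding infinitesimal_flex_def by blast
qed

lemma lattice_steps:
  "lattice (Suc i, k) - lattice (i, k) = e1"
  "lattice (i, Suc k) - lattice (i, k) = e2"
  "lattice (Suc i, Suc k) - lattice (i, k) = e1 + e2"
  "lattice (Suc i, k) - lattice (i, Suc k) = e1 - e2"
  by (simp_all add: lattice_diff)

lemma bar_condition_commute:
  "dN (lattice v - lattice w) (u v - u w) = 0 \<longleftrightarrow> dN (lattice w - lattice v) (u w - u v) = 0"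
proof (cases "v = w")
  case False
  then show ?thesis
    using dN_minus_eq_0_iff[OF lattice_diff_nonzero[OF False], of "u v - u w"] by simp
qed simp

end

lemma unit_distance_lattice_points:
  assumes "dist (lattice_point v) (lattice_point w) = 1"
  obtains i k where "{v, w} = {(i, k), (Suc i, k)}" | i k where "{v, w} = {(i, k), (i, Suc k)}"
proof -
  obtain i k i' k' where vw: "v = (i, k)" "w = (i', k')" by (cases v, cases w)
  \<comment> \<open>The differences are taken in the integers, where
    \<open>p\<^sup>2 + q\<^sup>2 = 1\<close> has only the four unit solutions.\<close>
  define p q where "p = int i - int i'" and "q = int k - int k'"
  have "(real i - real i')\<^sup>2 + (real k - real k')\<^sup>2 = 1"
    using assms by (simp add: vw lattice_point_def dist_vec_def L2_set_def sum_2 dist_real_def)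
  then have "real_of_int (p\<^sup>2 + q\<^sup>2) = real_of_int 1" by (simp add: p_def q_def)
  then have pq: "p\<^sup>2 + q\<^sup>2 = 1" by (simp only: of_int_eq_iff)
  have "\<bar>p\<bar> \<le> 1" "\<bar>q\<bar> \<le> 1"
    using pq abs_le_square_iff[of p 1] abs_le_square_iff[of q 1] zero_le_power2[of p] zero_le_power2[of q]
    by (auto simp del: zero_le_power2)
  then have "p \<in> {-1, 0, 1}" "q \<in> {-1, 0, 1}" by auto
  with pq consider "i = i'" "k = Suc k'" | "i = i'" "k' = Suc k" | "i = Suc i'" "k = k'" | "i' = Suc i" "k = k'"
    by (auto simp: p_def q_def)
  then show ?thesis
  proof cases
    case 1
    then show ?thesis using that(2)[of i k'] vw by (simp add: insert_commute)
  next
    case 2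
    then show ?thesis using that(2)[of i k] vw by simp
  next
    case 3
    then show ?thesis using that(1)[of i' k] vw by (simp add: insert_commute)
  next
    case 4
    then show ?thesis using that(1)[of i k] vw by simp
  qed
qed

lemma dist_lattice_points_unit:
  "dist (lattice_point (i, k)) (lattice_point (Suc i, k)) = 1"
  "dist (lattice_point (i, k)) (lattice_point (i, Suc k)) = 1"
  by (simp_all add: lattice_point_def dist_vec_def L2_set_def sum_2 dist_real_def)

text \<open>Bars are unordered pairs, so each is turned by \<open>bar_condition_commute\<close> into
  the orientation whose step is \<open>e1\<close>, \<open>e2\<close>, \<open>e1 + e2\<close> or
  \<open>e1 - e2\<close>.\<close>

lemma (in grid_norm) infinitesimal_flex_grid_iff:
  assumes B: "B \<subseteq> all_braces m n"
    and F: "bars F = grid_bars m n \<union> B" "joints F = grid_joints m n" "place F = (\<lambda>v. lattice v + a)"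
  shows "infinitesimal_flex N F u \<longleftrightarrow> grid_flex m n u \<and> (\<forall>e\<in>braces_graph m n B. brace_flex u e)"
proof -
  let ?P = "\<lambda>v w. dN (lattice v - lattice w) (u v - u w) = 0"
  have "bar_joint_framework F"
    using bar_joint_framework_braced_grid[OF B] F unfolding bar_joint_framework_def braced_grid_def by simp
  from infinitesimal_flex_iff[OF this F(3)]
  have "infinitesimal_flex N F u \<longleftrightarrow>
      (\<forall>v w. {v, w} \<in> grid_bars m n \<longrightarrow> ?P v w) \<and> (\<forall>v w. {v, w} \<in> B \<longrightarrow> ?P v w)"
    unfolding F(1) by blast
  also have "(\<forall>v w. {v, w} \<in> grid_bars m n \<longrightarrow> ?P v w) \<longleftrightarrow> grid_flex m n u"
  proof
    assume *: "\<forall>v w. {v, w} \<in> grid_bars m n \<longrightarrow> ?P v w"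
    have "{(Suc i, k), (i, k)} \<in> grid_bars m n" if "i < m" "k \<le> n" for i k
      unfolding grid_bars_def grid_joints_def using that dist_lattice_points_unit by (fastforce simp: dist_commute)
    moreover have "{(i, Suc k), (i, k)} \<in> grid_bars m n" if "i \<le> m" "k < n" for i k
      unfolding grid_bars_def grid_joints_def using that dist_lattice_points_unit by (fastforce simp: dist_commute)
    ultimately show "grid_flex m n u"
      unfolding grid_flex_def using * by (metis lattice_steps(1,2))
  next
    assume *: "grid_flex m n u"
    show "\<forall>v w. {v, w} \<in> grid_bars m n \<longrightarrow> ?P v w"
    proof (intro allI impI)
      fix v w assume vw: "{v, w} \<in> grid_bars m n"
      then have joints: "v \<in> grid_joints m n" "w \<in> grid_joints m n" and "dist (lattice_point v) (lattice_point w) = 1"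
        unfolding grid_bars_def by (auto simp: doubleton_eq_iff dist_commute)
      from this(3) show "?P v w"
      proof (cases rule: unit_distance_lattice_points)
        case (1 i k)
        then have "?P (Suc i, k) (i, k)"
          using * joints unfolding grid_flex_def lattice_steps grid_joints_def by (auto simp: doubleton_eq_iff)
        then show ?thesis using 1 bar_condition_commute by (metis doubleton_eq_iff)
      next
        case (2 i k)
        then have "?P (i, Suc k) (i, k)"
          using * joints unfolding grid_flex_def lattice_steps grid_joints_def by (auto simp: doubleton_eq_iff)
        then show ?thesis using 2 bar_condition_commute by (metis doubleton_eq_iff)
      qed
    qed
  qed
  also have "(\<forall>v w. {v, w} \<in> B \<longrightarrow> ?P v w) \<longleftrightarrow> (\<forall>e\<in>braces_graph m n B. brace_flex u e)"
  proof -
    have brace: "(\<forall>v w. {v, w} = brace e \<longrightarrow> ?P v w) \<longleftrightarrow> brace_flex u e" for e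
    proof -
      obtain i k c where e: "e = (i, k, c)" by (cases e)
      show ?thesis
      proof (cases c)
        case Blue
        have "brace_flex u e \<longleftrightarrow> ?P (Suc i, Suc k) (i, k)"
          unfolding lattice_steps e Blue by simp
        moreover have "brace e = {(Suc i, Suc k), (i, k)}" by (auto simp: e Blue)
        ultimately show ?thesis using bar_condition_commute by (metis doubleton_eq_iff)
      next
        case Red
        have "brace_flex u e \<longleftrightarrow> ?P (Suc i, k) (i, Suc k)"
          unfolding lattice_steps e Red by simp
        moreover have "brace e = {(Suc i, k), (i, Suc k)}" by (auto simp: e Red)
        ultimately show ?thesis using bar_condition_commute by (metis doubleton_eq_iff)
      qed
    qed
    have B_iff: "{v, w} \<in> B \<longleftrightarrow> (\<exists>e\<in>braces_graph m n B. {v, w} = brace e)" for v w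
      using B unfolding braces_graph_def all_braces_def K2_edges_def by fastforce
    have "(\<forall>v w. {v, w} \<in> B \<longrightarrow> ?P v w) \<longleftrightarrow>
        (\<forall>e\<in>braces_graph m n B. \<forall>v w. {v, w} = brace e \<longrightarrow> ?P v w)"
      unfolding B_iff by meson
    then show ?thesis by (simp only: brace)
  qed
  finally show ?thesis .
qed

section \<open>Rigid motion flexes and rigidity of grids\<close>

text \<open>Serves to approximate points of the plane by scaled lattice points. Rounding costs at
  most 1 before the division by \<open>n\<close>.\<close>

lemma floor_mult_div_tendsto: "(\<lambda>n. real_of_int \<lfloor>real n * r\<rfloor> / real n) \<longlonglongrightarrow> r"
proof (rule LIMSEQ_I)
  fix \<epsilon> :: real assume "\<epsilon> > 0"
  then obtain k where k: "1 / \<epsilon> < real k" using reals_Archimedean2 by blast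
  have "norm (real_of_int \<lfloor>real n * r\<rfloor> / real n - r) < \<epsilon>" if "n \<ge> k" for n
  proof -
    have "1 / \<epsilon> < real n" using k that by linarith
    moreover from this have "0 < real n" using \<open>\<epsilon> > 0\<close> by (meson divide_pos_pos less_trans zero_less_one)
    ultimately have n: "1 / real n < \<epsilon>" "0 < real n" using \<open>\<epsilon> > 0\<close> by (simp_all add: field_simps)
    have "\<bar>real_of_int \<lfloor>real n * r\<rfloor> - real n * r\<bar> \<le> 1" by linarith
    then have "\<bar>(real_of_int \<lfloor>real n * r\<rfloor> - real n * r) / real n\<bar> \<le> 1 / real n"
      using n(2) by (simp add: divide_right_mono)
    moreover have "(real_of_int \<lfloor>real n * r\<rfloor> - real n * r) / real n = real_of_int \<lfloor>real n * r\<rfloor> / real n - r"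
      using n(2) by (simp add: field_simps)
    ultimately show ?thesis using n(1) by simp
  qed
  then show "\<exists>k. \<forall>n\<ge>k. norm (real_of_int \<lfloor>real n * r\<rfloor> / real n - r) < \<epsilon>" by blast
qed

context grid_norm
begin

text \<open>By homogeneity and density it suffices to know the inequality on the lattice.\<close>

lemma euclidean_if_lattice_field:
  assumes A: "linear A" and inj: "\<And>x. A x = 0 \<Longrightarrow> x = 0"
    and int_ineq: "\<And>(p :: int) (q :: int) t. let z = p *\<^sub>R e1 + q *\<^sub>R e2 in N z \<le> N (z + t *\<^sub>R A z)"
  shows "euclidean_norm N"
proof (rule euclidean_if_tangent_linear_field[OF A inj])
  fix x :: "real^2" assume "x \<noteq> 0"
  obtain r s where x: "x = r *\<^sub>R e1 + s *\<^sub>R e2" using span by blast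
  have "N x \<le> N (x + t *\<^sub>R A x)" for t
  proof -
    define z where "z n = real_of_int \<lfloor>real n * r\<rfloor> *\<^sub>R e1 + real_of_int \<lfloor>real n * s\<rfloor> *\<^sub>R e2" for n
    define x' where "x' n = (1 / real n) *\<^sub>R z n" for n
    have "x' \<longlonglongrightarrow> x"
      unfolding x'_def z_def x
      using tendsto_add[OF tendsto_scaleR[OF floor_mult_div_tendsto[of r] tendsto_const[of e1]]
          tendsto_scaleR[OF floor_mult_div_tendsto[of s] tendsto_const[of e2]]]
      by (simp add: scaleR_add_right)
    have cont: "isCont N y" for y
      using N_continuous by (simp add: continuous_on_eq_continuous_at)
    have "(\<lambda>n. A (x' n)) \<longlonglongrightarrow> A x"
      using A \<open>x' \<longlonglongrightarrow> x\<close> linear_conv_bounded_linear bounded_linear.tendsto by blast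
    then have "(\<lambda>n. x' n + t *\<^sub>R A (x' n)) \<longlonglongrightarrow> x + t *\<^sub>R A x"
      by (intro tendsto_intros \<open>x' \<longlonglongrightarrow> x\<close>)
    then have lim: "(\<lambda>n. N (x' n + t *\<^sub>R A (x' n))) \<longlonglongrightarrow> N (x + t *\<^sub>R A x)"
      by (rule isCont_tendsto_compose[OF cont])
    \<comment> \<open>The factor \<open>1 / real n\<close> comes out on both sides; at
      \<open>n = 0\<close> it is 0 and both sides vanish.\<close>
    have "N (x' n) \<le> N (x' n + t *\<^sub>R A (x' n))" for n
    proof -
      have "x' n + t *\<^sub>R A (x' n) = (1 / real n) *\<^sub>R (z n + t *\<^sub>R A (z n))"
        by (simp add: x'_def linear_cmul[OF A] algebra_simps)
      moreover have "N (z n) \<le> N (z n + t *\<^sub>R A (z n))"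
        using int_ineq unfolding z_def Let_def by blast
      ultimately show ?thesis
        unfolding x'_def by (simp only: N_scale) (simp add: divide_right_mono)
    qed
    then show ?thesis
      using LIMSEQ_le[OF isCont_tendsto_compose[OF cont \<open>x' \<longlonglongrightarrow> x\<close>] lim] by blast
  qed
  then show "dN x (A x) = 0" by (simp add: dN_eq_0_iff_min[OF \<open>x \<noteq> 0\<close>])
qed

text \<open>The linear map with \<open>e1\<close> sent to \<open>s *\<^sub>R y1\<close> and
  \<open>e2\<close> to \<open>(brace_ratio Blue * s) *\<^sub>R y2\<close>, the only linear part that
  blue braces in all squares allow.\<close>

definition linear_part :: "real \<Rightarrow> real^2 \<Rightarrow> real^2" where
  "linear_part s x = (THE y. \<exists>p q. x = p *\<^sub>R e1 + q *\<^sub>R e2 \<and>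
     y = (s * p) *\<^sub>R y1 + (brace_ratio Blue * s * q) *\<^sub>R y2)"

lemma linear_part_eq:
  "linear_part s (p *\<^sub>R e1 + q *\<^sub>R e2) = (s * p) *\<^sub>R y1 + (brace_ratio Blue * s * q) *\<^sub>R y2"
  unfolding linear_part_def coordinates_unique by auto

lemma linear_linear_part: "linear (linear_part s)"
proof (rule linearI)
  fix x y :: "real^2" and c
  obtain p q p' q' where xy: "x = p *\<^sub>R e1 + q *\<^sub>R e2" "y = p' *\<^sub>R e1 + q' *\<^sub>R e2"
    using span by metis
  have "x + y = (p + p') *\<^sub>R e1 + (q + q') *\<^sub>R e2" "c *\<^sub>R x = (c * p) *\<^sub>R e1 + (c * q) *\<^sub>R e2"
    by (simp_all add: xy algebra_simps)
  then show "linear_part s (x + y) = linear_part s x + linear_part s y"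
    "linear_part s (c *\<^sub>R x) = c *\<^sub>R linear_part s x"
    by (simp_all only: xy linear_part_eq) (simp_all add: algebra_simps)
qed

lemma linear_part_eq_0:
  assumes "s \<noteq> 0" and "linear_part s x = 0"
  shows "x = 0"
proof -
  obtain p q where "x = p *\<^sub>R e1 + q *\<^sub>R e2" using span by blast
  then show ?thesis
    using assms brace_ratio_pos[of Blue] by (simp add: linear_part_eq y_indep)
qed

section \<open>Rigid motion flexes are the translations\<close>

definition complete_lattice_framework :: "real^2 \<Rightarrow> (nat \<times> nat) framework" where
  "complete_lattice_framework a =
     \<lparr>joints = UNIV, bars = {{v, w} | v w. v \<noteq> w}, place = (\<lambda>v. lattice v + a)\<rparr>"

lemma complete_lattice_framework_simps [simp]:
  "joints (complete_lattice_framework a) = UNIV"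
  "bars (complete_lattice_framework a) = {{v, w} | v w. v \<noteq> w}"
  "place (complete_lattice_framework a) = (\<lambda>v. lattice v + a)"
  by (simp_all only: complete_lattice_framework_def framework.simps)

lemma bar_joint_complete_lattice_framework: "bar_joint_framework (complete_lattice_framework a)"
  unfolding bar_joint_framework_def complete_lattice_framework_simps by blast

text \<open>The unit steps and blue diagonals among the bars already make \<open>u\<close> affine.
  The remaining bars make its linear part tangent at every integer vector, which the non-Euclidean
  norm permits only for \<open>s = 0\<close>.\<close>

lemma complete_lattice_flex_const:
  assumes "infinitesimal_flex N (complete_lattice_framework a) u" and "\<not> euclidean_norm N"
  shows "u v = u (0, 0)"
proof -
  have bar: "dN (lattice v - lattice w) (u v - u w) = 0" if "v \<noteq> w" for v w
  proof -
    have "{v, w} \<in> bars (complete_lattice_framework a)"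
      unfolding complete_lattice_framework_simps using that by blast
    then show ?thesis
      using assms(1) infinitesimal_flex_iff[OF bar_joint_complete_lattice_framework
          complete_lattice_framework_simps(3)] by blast
  qed
  have "dN e1 (u (Suc i, k) - u (i, k)) = 0" "dN e2 (u (i, Suc k) - u (i, k)) = 0" for i k
    using bar[of "(Suc i, k)" "(i, k)"] bar[of "(i, Suc k)" "(i, k)"] by (simp_all add: lattice_steps)
  then have grid: "grid_flex M M u" for M
    unfolding grid_flex_def by blast
  have brace: "brace_flex u (i, k, Blue)" for i k
    using bar[of "(Suc i, Suc k)" "(i, k)"] by (simp add: lattice_steps)
  have "u (1, 0) - u (0, 0) \<in> range (\<lambda>s. s *\<^sub>R y1)"
    using grid[of 1] unfolding grid_flex_def dN_e1_eq_0 by fastforce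
  then obtain s where s: "u (1, 0) - u (0, 0) = s *\<^sub>R y1" by blast
  have u: "u v = u (0, 0) + linear_part s (lattice v)" for v
  proof -
    obtain i k where v: "v = (i, k)" by (cases v)
    \<comment> \<open>The successor guarantees a square at the origin even for
      \<open>v = (0, 0)\<close>.\<close>
    define M where "M = Suc (max i k)"
    obtain x where x: "\<And>i k. i \<le> M \<Longrightarrow> k \<le> M \<Longrightarrow> u (i, k) = shear_flex (u (0, 0)) x (i, k)"
      using grid_flex_imp_shear_flex[OF grid] by metis
    have "x (Inl 0) *\<^sub>R y1 = s *\<^sub>R y1"
      using s x[of 1 0] x[of 0 0] by (simp add: M_def shear_flex_def)
    then have "x (Inl 0) = s" using y_unique[of "x (Inl 0)" 0 s 0] by simp
    have ratio: "x (Inr k) = brace_ratio Blue * x (Inl i)" if "i < M" "k < M" for i k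
    proof -
      have "brace_flex (shear_flex (u (0, 0)) x) (i, k, Blue)"
        using brace[of i k] x[of i k] x[of "Suc i" "Suc k"] that by simp
      then show ?thesis by (simp only: brace_flex_shear_flex)
    qed
    \<comment> \<open>Column 0 determines all rows, and row 0 in turn all columns.\<close>
    have xr: "x (Inr k) = brace_ratio Blue * s" if "k < M" for k
      using ratio[of 0 k] that \<open>x (Inl 0) = s\<close> by (simp add: M_def)
    have xl: "x (Inl i) = s" if "i < M" for i
      using ratio[OF that, of 0] xr[of 0] brace_ratio_pos[of Blue] by (simp add: M_def)
    have "(\<Sum>j<i. x (Inl j)) = s * real i" "(\<Sum>j<k. x (Inr j)) = brace_ratio Blue * s * real k"
      using xl xr by (simp_all add: M_def)
    then have "shear_flex (u (0, 0)) x (i, k) = u (0, 0) + linear_part s (lattice (i, k))"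
      by (simp add: shear_flex_def lattice_def linear_part_eq)
    then show ?thesis using x[of i k] by (simp add: v M_def)
  qed
  have "s = 0"
  proof (rule ccontr)
    assume "s \<noteq> 0"
    have "euclidean_norm N"
    proof (rule euclidean_if_lattice_field[of "linear_part s"])
      fix p q :: int and t :: real
      define z where "z = real_of_int p *\<^sub>R e1 + real_of_int q *\<^sub>R e2"
      \<comment> \<open>Positive and negative parts: the joints fill only a quadrant, but their
        differences fill the whole integer lattice.\<close>
      define v w where "v = (nat p, nat q)" and "w = (nat (- p), nat (- q))"
      have "real (nat j) - real (nat (- j)) = real_of_int j" for j
        by (cases "0 \<le> j") auto
      then have z: "z = lattice v - lattice w"
        by (simp add: z_def v_def w_def lattice_diff)
      have "u v - u w = linear_part s z"
        by (simp add: u[of v] u[of w] z linear_diff[OF linear_linear_part])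
      have "N z \<le> N (z + t *\<^sub>R linear_part s z)"
      proof (cases "v = w")
        case True
        then show ?thesis using N_nonneg N_eq_0[of 0] by (simp add: z)
      next
        case False
        then show ?thesis
          using bar[OF False] dN_eq_0_iff_min[OF lattice_diff_nonzero[OF False]]
            \<open>u v - u w = linear_part s z\<close> by (simp add: z)
      qed
      then show "let z = p *\<^sub>R e1 + q *\<^sub>R e2 in N z \<le> N (z + t *\<^sub>R linear_part s z)"
        by (simp add: z_def Let_def)
    qed (use linear_linear_part linear_part_eq_0[OF \<open>s \<noteq> 0\<close>] in auto)
    then show False using assms(2) by blast
  qed
  obtain p q where "lattice v = p *\<^sub>R e1 + q *\<^sub>R e2" using span by blast
  then show ?thesis using u[of v] by (simp add: \<open>s = 0\<close> linear_part_eq)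
qed

text \<open>A constant field extends to every framework. Conversely, the extension to the complete
  lattice framework is constant.\<close>

lemma rigid_motion_flex_iff:
  assumes "\<not> euclidean_norm N" and F: "bar_joint_framework F" "place F = (\<lambda>v. lattice v + a)"
    and "(0, 0) \<in> joints F"
  shows "rigid_motion_flex N F u \<longleftrightarrow> (\<forall>v\<in>joints F. u v = u (0, 0))"
proof
  assume u: "rigid_motion_flex N F u"
  have bars: "bars F \<subseteq> {{v, w} | v w. v \<noteq> w}"
  proof
    show "b \<in> {{v, w} | v w. v \<noteq> w}" if "b \<in> bars F" for b
      using subsetD[OF F(1)[unfolded bar_joint_framework_def] that] by blast
  qed
  have "subframework F (complete_lattice_framework a)"
    unfolding subframework_def complete_lattice_framework_simps F(2)
    by (intro conjI ballI refl subset_UNIV bars)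
  with bar_joint_complete_lattice_framework obtain u' where "infinitesimal_flex N (complete_lattice_framework a) u'"
    and u': "\<And>v. v \<in> joints F \<Longrightarrow> u' v = u v"
    using u unfolding rigid_motion_flex_def by blast
  then have "u' v = u' (0, 0)" for v
    using complete_lattice_flex_const assms(1) by blast
  then show "\<forall>v\<in>joints F. u v = u (0, 0)"
    using u' assms(4) by metis
next
  assume u: "\<forall>v\<in>joints F. u v = u (0, 0)"
  have "infinitesimal_flex N F' (\<lambda>_. u (0, 0))" for F'
    unfolding infinitesimal_flex_def by (simp add: algebra_simps)
  moreover have "infinitesimal_flex N F u"
  proof -
    have "dN (lattice v - lattice w) (u v - u w) = 0" if "{v, w} \<in> bars F" for v w
    proof -
      have "v \<in> joints F" "w \<in> joints F" "v \<noteq> w"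
        using F(1) that unfolding bar_joint_framework_def by (auto simp: doubleton_eq_iff)
      then show ?thesis using u dN_linear(4)[OF lattice_diff_nonzero] by (metis diff_self)
    qed
    then show ?thesis using infinitesimal_flex_iff[OF F] by blast
  qed
  ultimately show "rigid_motion_flex N F u"
    using u unfolding rigid_motion_flex_def by (metis)
qed

text \<open>Shears parametrise the flexes of the unbraced grid, the braces turn into
  \<open>brace_solution\<close>, and a shear is constant on the grid iff its parameters
  vanish.\<close>

lemma infinitesimally_rigid_grid_iff:
  assumes "\<not> euclidean_norm N" and B: "B \<subseteq> all_braces m n"
    and F: "bars F = grid_bars m n \<union> B" "joints F = grid_joints m n" "place F = (\<lambda>v. lattice v + a)"
  shows "infinitesimally_rigid N F \<longleftrightarrow>
    (\<forall>x. brace_solution brace_ratio (braces_graph m n B) x \<longrightarrow> (\<forall>v\<in>K2_vertices m n. x v = 0))"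
proof -
  have bj: "bar_joint_framework F"
    using bar_joint_framework_braced_grid[OF B] F unfolding bar_joint_framework_def braced_grid_def by simp
  have rigid: "infinitesimally_rigid N F \<longleftrightarrow>
      (\<forall>u. grid_flex m n u \<and> (\<forall>e\<in>braces_graph m n B. brace_flex u e) \<longrightarrow>
        (\<forall>v\<in>grid_joints m n. u v = u (0, 0)))"
    using rigid_motion_flex_iff[OF assms(1) bj F(3)] infinitesimal_flex_grid_iff[OF B F]
    unfolding infinitesimally_rigid_def by (simp add: F(2) grid_joints_def)
  have solution: "(\<forall>e\<in>braces_graph m n B. brace_flex (shear_flex c x) e) \<longleftrightarrow>
      brace_solution brace_ratio (braces_graph m n B) x" for c x
    unfolding brace_solution_def using brace_flex_shear_flex by fast
  show ?thesis
    unfolding rigid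
  proof (intro iffI allI impI)
    fix x
    assume *: "\<forall>u. grid_flex m n u \<and> (\<forall>e\<in>braces_graph m n B. brace_flex u e) \<longrightarrow>
        (\<forall>v\<in>grid_joints m n. u v = u (0, 0))"
      and "brace_solution brace_ratio (braces_graph m n B) x"
    then have const: "shear_flex 0 x v = 0" if "v \<in> grid_joints m n" for v
      using solution[of 0 x] grid_flex_shear_flex[of m n 0 x] that by (force simp: shear_flex_def)
    have "x (Inl i) = 0" if "i < m" for i
    proof -
      have "x (Inl i) *\<^sub>R y1 = shear_flex 0 x (Suc i, 0) - shear_flex 0 x (i, 0)"
        by (simp add: shear_flex_def algebra_simps)
      also have "\<dots> = 0" using const that by (simp add: grid_joints_def)
      finally show ?thesis using y_indep[of "x (Inl i)" 0] by simp
    qed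
    moreover have "x (Inr k) = 0" if "k < n" for k
    proof -
      have "x (Inr k) *\<^sub>R y2 = shear_flex 0 x (0, Suc k) - shear_flex 0 x (0, k)"
        by (simp add: shear_flex_def algebra_simps)
      also have "\<dots> = 0" using const that by (simp add: grid_joints_def)
      finally show ?thesis using y_indep[of 0 "x (Inr k)"] by simp
    qed
    ultimately show "\<forall>v\<in>K2_vertices m n. x v = 0" unfolding K2_vertices_def by auto
  next
    fix u
    assume *: "\<forall>x. brace_solution brace_ratio (braces_graph m n B) x \<longrightarrow> (\<forall>v\<in>K2_vertices m n. x v = 0)"
      and u: "grid_flex m n u \<and> (\<forall>e\<in>braces_graph m n B. brace_flex u e)"
    obtain x where x: "\<And>i k. i \<le> m \<Longrightarrow> k \<le> n \<Longrightarrow> u (i, k) = shear_flex (u (0, 0)) x (i, k)"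
      using grid_flex_imp_shear_flex u by blast
    \<comment> \<open>\<open>u\<close> is known to be a shear only on the joints of the grid, so it
      matters that the corners of the braced square are among them.\<close>
    have "brace_flex (shear_flex (u (0, 0)) x) e" if e: "e \<in> braces_graph m n B" for e
    proof -
      obtain i k c where ikc: "e = (i, k, c)" by (cases e)
      then have "i < m" "k < n" using e by (auto simp: braces_graph_def K2_edges_def)
      moreover have "brace_flex u (i, k, c)" using u e ikc by blast
      ultimately show ?thesis
        using x[of i k] x[of "Suc i" "Suc k"] x[of "Suc i" k] x[of i "Suc k"] by (cases c) (auto simp: ikc)
    qed
    then have "\<forall>v\<in>K2_vertices m n. x v = 0" using * solution by blast
    then have "shear_flex (u (0, 0)) x (i, k) = u (0, 0)" if "i \<le> m" "k \<le> n" for i k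
      using that by (simp add: shear_flex_def K2_vertices_def)
    then have const: "u (i, k) = u (0, 0)" if "i \<le> m" "k \<le> n" for i k
      using x[OF that] that by metis
    show "\<forall>v\<in>grid_joints m n. u v = u (0, 0)"
    proof
      fix v assume "v \<in> grid_joints m n"
      then have "fst v \<le> m" "snd v \<le> n" by (auto simp: grid_joints_def)
      then show "u v = u (0, 0)" using const[of "fst v" "snd v"] by (simp only: prod.collapse)
    qed
  qed
qed

end

lemma braces_graph_all: "braces_graph m n (all_braces m n) = K2_edges m n"
  unfolding braces_graph_def all_braces_def K2_edges_def by auto

text \<open>With equal ratios, 1 on columns and the common ratio on rows solves all equations.
  Rigidity of the fully braced grid thus supplies the distinct weights that the cycle criterion
  needs.\<close>

lemma K2_edges_only_zero_imp_distinct_ratios: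
  assumes "m \<ge> 1" and "\<forall>x. brace_solution w (K2_edges m n) x \<longrightarrow> (\<forall>v\<in>K2_vertices m n. x v = 0)"
  shows "w Blue \<noteq> w Red"
proof
  assume "w Blue = w Red"
  then have w: "w Blue = w c" for c by (cases c) auto
  have "brace_solution w (K2_edges m n) (\<lambda>v. if isl v then 1 else w Blue)"
    unfolding brace_solution_def by (auto intro: w)
  moreover have "Inl 0 \<in> K2_vertices m n" using assms(1) by (auto simp: K2_vertices_def)
  ultimately show False using assms(2) by fastforce
qed

lemma grid_norm_rotation:
  assumes "is_norm N" "differentiable_norm N" "strictly_convex_norm N"
  shows "grid_norm N (vector [cos \<alpha>, sin \<alpha>]) (vector [- sin \<alpha>, cos \<alpha>])"
proof
  have cs: "cos \<alpha> * cos \<alpha> + sin \<alpha> * sin \<alpha> = 1"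
    using sin_cos_squared_add2[of \<alpha>] by (simp add: power2_eq_square)
  let ?e = "vector [cos \<alpha>, sin \<alpha>] :: real^2" and ?f = "vector [- sin \<alpha>, cos \<alpha>] :: real^2"
  show "s = 0 \<and> t = 0" if "s *\<^sub>R ?e + t *\<^sub>R ?f = 0" for s t
  proof -
    have "s * cos \<alpha> - t * sin \<alpha> = 0" "s * sin \<alpha> + t * cos \<alpha> = 0"
      using that by (simp_all add: vec_eq_iff forall_2)
    then show ?thesis using cs by algebra
  qed
  show "\<exists>s t. x = s *\<^sub>R ?e + t *\<^sub>R ?f" for x :: "real^2"
  proof (intro exI)
    \<comment> \<open>The coordinates come from the inverse rotation.\<close>
    show "x = (x$1 * cos \<alpha> + x$2 * sin \<alpha>) *\<^sub>R ?e + (x$2 * cos \<alpha> - x$1 * sin \<alpha>) *\<^sub>R ?f"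
      unfolding vec_eq_iff forall_2
      by (intro conjI; simp) (use cs in algebra)+
  qed
qed (use assms in auto)

theorem theorem1p1:
  fixes m n :: nat and N :: "real^2 \<Rightarrow> real" and \<alpha> :: real and a :: "real^2"
    and B :: "(nat \<times> nat) set set"
  assumes "m \<ge> 1" and "n \<ge> 1"
    and "is_norm N" and "differentiable_norm N" and "strictly_convex_norm N"
    and "\<not> euclidean_norm N"
    and "0 \<le> \<alpha>" and "\<alpha> < pi / 2"
    and "B \<subseteq> all_braces m n"
  shows "infinitesimally_rigid N (braced_grid m n \<alpha> a B) \<longleftrightarrow>
     infinitesimally_rigid N (braced_grid m n \<alpha> a (all_braces m n)) \<and>
     spanning m n (braces_graph m n B) \<and>
     independent_cycle_in_each_component (braces_graph m n B)"
proof -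
  interpret grid_norm N "vector [cos \<alpha>, sin \<alpha>]" "vector [- sin \<alpha>, cos \<alpha>]"
    using assms by (intro grid_norm_rotation)
  have place: "rotate_by \<alpha> (lattice_point v) = lattice v" for v
    by (simp add: rotate_by_def lattice_point_def lattice_def vec_eq_iff forall_2 mult.commute)
  let ?only_zero = "\<lambda>E. \<forall>x. brace_solution brace_ratio E x \<longrightarrow> (\<forall>v\<in>K2_vertices m n. x v = 0)"
  have rigid: "infinitesimally_rigid N (braced_grid m n \<alpha> a B') \<longleftrightarrow> ?only_zero (braces_graph m n B')"
    if "B' \<subseteq> all_braces m n" for B'
    by (rule infinitesimally_rigid_grid_iff[OF assms(6) that]) (simp_all add: braced_grid_def place)
  have sub: "braces_graph m n B \<subseteq> K2_edges m n" by (auto simp: braces_graph_def)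
  \<comment> \<open>Adding braces adds equations, so the zero solution stays the only one.\<close>
  then have mono: "?only_zero (braces_graph m n B) \<Longrightarrow> ?only_zero (K2_edges m n)"
    unfolding brace_solution_def by blast
  have distinct: "?only_zero (K2_edges m n) \<Longrightarrow> brace_ratio Blue \<noteq> brace_ratio Red"
    using K2_edges_only_zero_imp_distinct_ratios assms(1) by blast
  show ?thesis
    unfolding rigid[OF assms(9)] rigid[OF order_refl] braces_graph_all
    using mono distinct only_zero_brace_solution_iff[where w = brace_ratio, OF brace_ratio_pos _ sub] by blast
qed

end
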